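(* Let $d\ge 1$, let $n=\sum_{j=1}^d n_j$ with $n_1,\ldots,n_d$ positive integers, and let $p(z_1,\ldots,z_d)$ be a multivariable polynomial with complex coefficients and $p(0,\ldots,0)\neq 0$ that is given by a determinantal representation $$ p(z_1, \ldots , z_d) = p(0,\ldots,0) \det \left(I_n- K (\oplus_{j=1}^d z_j I_{n_j})\right), $$ with $K \in {\mathbb C}^{n\times n}$. For $m\in\mathbb{N}$ and $U_1,\ldots , U_d \in {\mathbb C}^{m \times m}$ define $$ p(U_1, \ldots , U_d) = p(0,\ldots,0) \det \left(I_n\otimes I_m- (K\otimes I_m) (\oplus_{j=1}^d I_{n_j}\otimes U_j)\right).$$ Then the following are equivalent. (i) $p(U_1, \ldots , U_d)\neq 0$ for all $m\in\mathbb{N}$ and all $d$-tuples of unitary matrices $(U_1, \ldots , U_d) \in ({\mathbb C}^{m\times m})^d$. (ii) $p(U_1, \ldots , U_d)\neq 0$ for all $m\in\{1,\ldots,n\}$ and all $d$-tuples of unitary matrices $(U_1, \ldots , U_d) \in ({\mathbb C}^{m\times m})^d$. (iii) There exists an invertible $S=\oplus_{j=1}^d S_j$, with $S_j\in{\mathbb C}^{n_j\times n_j}$, $j=1,\ldots, d$, such that $S^{-1}KS$ is a strict $J$-contraction for some diagonal signature matrix $J\in\mathbb{C}^{n\times n}$.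
   Context: $\mathbb{N}=\{1,2,3,\ldots\}$. $\otimes$ is the Kronecker product and $\oplus$ denotes the block diagonal direct sum of matrices. A signature matrix is a matrix $J$ with $J^*=J=J^{-1}$; thus a diagonal signature matrix is a diagonal matrix each of whose diagonal entries is $1$ or $-1$. A matrix $M$ is a strict $J$-contraction if $J-MJM^*$ is positive definite. *)

theory Defs
  imports
    "HOL-Library.Poly_Mapping"
    "Jordan_Normal_Form.Determinant"
    "Jordan_Normal_Form.Gauss_Jordan_Elimination"
    "Jordan_Normal_Form.Schur_Decomposition"
begin

text \<open>
  A complex polynomial in variables indexed by \<^typ>\<open>nat\<close> is a finitely supported map from
  exponent vectors to coefficients. The variables \<open>z\<^sub>1, \<dots>, z\<^sub>d\<close> carry the indices \<open>0, \<dots>, d - 1\<close>.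
\<close>

type_synonym cmpoly = "(nat \<Rightarrow>\<^sub>0 nat) \<Rightarrow>\<^sub>0 complex"

definition poly_in_vars :: "nat \<Rightarrow> cmpoly \<Rightarrow> bool" where
  "poly_in_vars d p \<longleftrightarrow> (\<forall>e \<in> Poly_Mapping.keys p. Poly_Mapping.keys e \<subseteq> {..<d})"

definition poly_eval :: "cmpoly \<Rightarrow> (nat \<Rightarrow> complex) \<Rightarrow> complex" where
  "poly_eval p z =
     (\<Sum>e \<in> Poly_Mapping.keys p. Poly_Mapping.lookup p e *
        (\<Prod>i \<in> Poly_Mapping.keys e. z i ^ Poly_Mapping.lookup e i))"

definition kronecker :: "complex mat \<Rightarrow> complex mat \<Rightarrow> complex mat" (infixl \<open>\<otimes>\<^sub>K\<close> 75) where
  "A \<otimes>\<^sub>K B = mat (dim_row A * dim_row B) (dim_col A * dim_col B)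
     (\<lambda>(i, j). A $$ (i div dim_row B, j div dim_col B) * B $$ (i mod dim_row B, j mod dim_col B))"

definition direct_sum_mat :: "nat \<Rightarrow> (nat \<Rightarrow> complex mat) \<Rightarrow> complex mat" where
  "direct_sum_mat d A = diag_block_mat (map A [0..<d])"

definition unitary_mat :: "complex mat \<Rightarrow> bool" where
  "unitary_mat U \<longleftrightarrow>
     square_mat U \<and> inverts_mat U (mat_adjoint U) \<and> inverts_mat (mat_adjoint U) U"

text \<open>The form \<^term>\<open>(A *\<^sub>v v) \<bullet>c v\<close> is \<open>v\<^sup>* A v\<close>, which is real for Hermitian \<open>A\<close>.\<close>

definition positive_definite_mat :: "complex mat \<Rightarrow> bool" where
  "positive_definite_mat A \<longleftrightarrow> square_mat A \<and> mat_adjoint A = A \<and>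
     (\<forall>v \<in> carrier_vec (dim_row A). v \<noteq> 0\<^sub>v (dim_row A) \<longrightarrow> Re ((A *\<^sub>v v) \<bullet>c v) > 0)"

text \<open>The condition \<^term>\<open>inverts_mat J J\<close> says \<open>J = J\<^sup>-\<^sup>1\<close>.\<close>

definition signature_mat :: "complex mat \<Rightarrow> bool" where
  "signature_mat J \<longleftrightarrow> square_mat J \<and> mat_adjoint J = J \<and> inverts_mat J J"

definition strict_contraction_wrt :: "complex mat \<Rightarrow> complex mat \<Rightarrow> bool" where
  "strict_contraction_wrt J M \<longleftrightarrow> positive_definite_mat (J - M * J * mat_adjoint M)"

definition det_rep :: "nat \<Rightarrow> (nat \<Rightarrow> nat) \<Rightarrow> complex mat \<Rightarrow> cmpoly \<Rightarrow> bool" where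
  "det_rep d ns K p \<longleftrightarrow> (let n = (\<Sum>j<d. ns j) in
     \<forall>z. poly_eval p z =
       poly_eval p (\<lambda>_. 0) * det (1\<^sub>m n - K * direct_sum_mat d (\<lambda>j. z j \<cdot>\<^sub>m 1\<^sub>m (ns j))))"

text \<open>
  The value \<open>p(U\<^sub>1, \<dots>, U\<^sub>d)\<close> at \<open>m \<times> m\<close> matrices, which is defined through the representation
  and so takes its data \<open>d\<close>, \<open>ns\<close>, \<open>K\<close> as arguments.
\<close>

definition eval_at_mats ::
  "nat \<Rightarrow> (nat \<Rightarrow> nat) \<Rightarrow> complex mat \<Rightarrow> cmpoly \<Rightarrow> nat \<Rightarrow> (nat \<Rightarrow> complex mat) \<Rightarrow> complex" where
  "eval_at_mats d ns K p m U = (let n = (\<Sum>j<d. ns j) in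
     poly_eval p (\<lambda>_. 0) *
     det (1\<^sub>m n \<otimes>\<^sub>K 1\<^sub>m m - (K \<otimes>\<^sub>K 1\<^sub>m m) * direct_sum_mat d (\<lambda>j. 1\<^sub>m (ns j) \<otimes>\<^sub>K U j)))"

end

theory Submission
  imports Defs "HOL-Analysis.Function_Topology"
begin

text \<open>
  Write \<open>D\<close> for \<open>\<oplus>\<^sub>j (I \<otimes> U\<^sub>j)\<close>. The value \<open>p(U\<^sub>1, \<dots>, U\<^sub>d)\<close> vanishes exactly when
  \<open>I - (K \<otimes> I) D\<close> has a left kernel vector. Conjugated and folded into an \<open>n \<times> m\<close> matrix \<open>Y\<close>,
  such a vector satisfies: row \<open>k\<close> of \<open>Y\<close> is \<open>U\<^sub>j\<^sup>*\<close> applied to row \<open>k\<close> of \<open>K\<^sup>* Y\<close>, where \<open>j\<close> is the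
  block that contains \<open>k\<close> (\<open>eval_at_mats_zero_iff\<close>). The rows of one block share their unitary
  matrix, and two families of vectors are related by a unitary matrix exactly when their Gram
  matrices agree (\<open>isometry_of_equal_gram\<close>). Hence suitable \<open>U\<^sub>j\<close> exist for some nonzero \<open>Y\<close> if and
  only if the diagonal blocks of \<open>Y Y\<^sup>* - K\<^sup>* Y Y\<^sup>* K\<close> all vanish for some nonzero \<open>Y\<close>
  (\<open>zero_at_unitaries_iff\<close>). Left kernel vectors are used, rather than right ones, because they put
  \<open>K\<^sup>*\<close> on the left in this expression; the dual inequality below then has the form required of a
  strict \<open>J\<close>-contraction.
  
  The size \<open>m = n\<close> already decides the matter: every positive semidefinite \<open>n \<times> n\<close> matrix is
  \<open>Y Y\<^sup>*\<close> for a square \<open>Y\<close> (\<open>psd_factorization\<close>). So if \<open>p\<close> has no unitary zeros of size \<open>n\<close>, then no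
  nonzero positive semidefinite \<open>P\<close> has the property that all diagonal blocks of \<open>P - K\<^sup>* P K\<close>
  vanish. As \<open>P\<close> runs through the positive semidefinite matrices of trace 1, these block diagonal
  parts form a compact convex set that avoids 0. Its element \<open>H\<close> of least norm separates it
  from 0, and for \<open>P = v v\<^sup>*\<close> the separation inequality reads
  \<open>v\<^sup>* (H - K H K\<^sup>*) v \<ge> c |v|\<^sup>2\<close> with \<open>c > 0\<close> (\<open>block_separation\<close>). A small shift makes \<open>H\<close> an
  invertible block diagonal Hermitian matrix \<open>G\<close> with \<open>G - K G K\<^sup>*\<close> positive definite
  (\<open>block_stein_solution\<close>). Diagonalizing each block gives \<open>G = S J S\<^sup>*\<close> with \<open>S\<close> block diagonal and
  \<open>J\<close> a diagonal signature matrix, and \<open>G - K G K\<^sup>* = S (J - M J M\<^sup>*) S\<^sup>*\<close> for \<open>M = S\<^sup>-\<^sup>1 K S\<close>, so \<open>M\<close>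
  is a strict \<open>J\<close>-contraction.
  
  Conversely, a strict \<open>J\<close>-contraction \<open>S\<^sup>-\<^sup>1 K S\<close> gives such a \<open>G = S J S\<^sup>*\<close>. Pairing the block
  diagonal \<open>G\<close> with \<open>Y Y\<^sup>* - K\<^sup>* Y Y\<^sup>* K\<close> only sees the diagonal blocks of the latter, and the result
  is a sum of values of the form of \<open>G - K G K\<^sup>*\<close> at the columns of \<open>Y\<close>, hence positive for
  nonzero \<open>Y\<close> of any width \<open>m\<close> (\<open>defect_of_stein_positive\<close>).
\<close>

section \<open>Adjoints and entries of products\<close>

lemma dim_mat_adjoint [simp]:
  "dim_row (mat_adjoint A) = dim_col A" "dim_col (mat_adjoint A) = dim_row A"
  by (auto simp: mat_adjoint_def)

lemma mat_adjoint_carrier [simp, intro]: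
  "A \<in> carrier_mat m n \<Longrightarrow> mat_adjoint A \<in> carrier_mat n m"
  unfolding carrier_mat_def by auto

lemma index_mat_adjoint [simp]:
  fixes A :: "complex mat"
  shows "i < dim_col A \<Longrightarrow> j < dim_row A \<Longrightarrow> mat_adjoint A $$ (i, j) = cnj (A $$ (j, i))"
  by (simp add: mat_adjoint_def mat_of_rows_def)

lemma index_mult_mat_sum:
  "A \<in> carrier_mat m n \<Longrightarrow> B \<in> carrier_mat n r \<Longrightarrow> i < m \<Longrightarrow> j < r \<Longrightarrow>
    (A * B) $$ (i, j) = (\<Sum>k<n. A $$ (i, k) * B $$ (k, j))"
  by (simp add: scalar_prod_def lessThan_atLeast0)

lemma index_mult_mat_vec_sum:
  "A \<in> carrier_mat m n \<Longrightarrow> v \<in> carrier_vec n \<Longrightarrow> i < m \<Longrightarrow>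
    (A *\<^sub>v v) $ i = (\<Sum>k<n. A $$ (i, k) * v $ k)"
  by (simp add: scalar_prod_def lessThan_atLeast0)

lemma cscalar_prod_sum:
  fixes v w :: "complex vec"
  shows "w \<in> carrier_vec n \<Longrightarrow> v \<bullet>c w = (\<Sum>k<n. v $ k * cnj (w $ k))"
  by (simp add: scalar_prod_def lessThan_atLeast0)

lemma mat_adjoint_mult:
  fixes A B :: "complex mat"
  assumes "A \<in> carrier_mat m n" "B \<in> carrier_mat n r"
  shows "mat_adjoint (A * B) = mat_adjoint B * mat_adjoint A"
proof (rule eq_matI)
  fix i j assume "i < dim_row (mat_adjoint B * mat_adjoint A)" "j < dim_col (mat_adjoint B * mat_adjoint A)"
  then have ij: "i < r" "j < m" using assms by auto
  have "mat_adjoint (A * B) $$ (i, j) = cnj (\<Sum>k<n. A $$ (j, k) * B $$ (k, i))"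
    using ij assms by (simp add: index_mult_mat_sum[OF assms] del: index_mult_mat(1))
  also have "\<dots> = (\<Sum>k<n. mat_adjoint B $$ (i, k) * mat_adjoint A $$ (k, j))"
    unfolding cnj_sum using ij assms by (intro sum.cong) auto
  also have "\<dots> = (mat_adjoint B * mat_adjoint A) $$ (i, j)"
    using index_mult_mat_sum[OF mat_adjoint_carrier[OF assms(2)] mat_adjoint_carrier[OF assms(1)] ij] by simp
  finally show "mat_adjoint (A * B) $$ (i, j) = (mat_adjoint B * mat_adjoint A) $$ (i, j)" .
qed (use assms in auto)

lemma mat_adjoint_adjoint [simp]:
  fixes A :: "complex mat"
  shows "mat_adjoint (mat_adjoint A) = A"
  by (rule eq_matI) auto

lemma mat_adjoint_one [simp]: "mat_adjoint (1\<^sub>m n :: complex mat) = 1\<^sub>m n"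
  by (rule eq_matI) auto

lemma cscalar_prod_adjoint:
  fixes A :: "complex mat"
  assumes A: "A \<in> carrier_mat m n" and v: "v \<in> carrier_vec n" and w: "w \<in> carrier_vec m"
  shows "(A *\<^sub>v v) \<bullet>c w = v \<bullet>c (mat_adjoint A *\<^sub>v w)"
proof -
  have "(A *\<^sub>v v) \<bullet>c w = (\<Sum>i<m. \<Sum>k<n. A $$ (i, k) * v $ k * cnj (w $ i))"
    using w by (simp add: cscalar_prod_sum index_mult_mat_vec_sum[OF A v] sum_distrib_right
        del: index_mult_mat_vec)
  also have "\<dots> = (\<Sum>k<n. \<Sum>i<m. A $$ (i, k) * v $ k * cnj (w $ i))"
    by (rule sum.swap)
  also have "\<dots> = (\<Sum>k<n. v $ k * cnj (\<Sum>i<m. mat_adjoint A $$ (k, i) * w $ i))"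
    unfolding cnj_sum sum_distrib_left using A by (intro sum.cong) auto
  also have "\<dots> = v \<bullet>c (mat_adjoint A *\<^sub>v w)"
    unfolding cscalar_prod_sum[OF mult_mat_vec_carrier[OF mat_adjoint_carrier[OF A] w]]
    by (intro sum.cong) (simp_all only: index_mult_mat_vec_sum[OF mat_adjoint_carrier[OF A] w] lessThan_iff)
  finally show ?thesis .
qed

lemma cscalar_prod_self:
  fixes v :: "complex vec"
  assumes "v \<in> carrier_vec n"
  shows "v \<bullet>c v = of_real (\<Sum>k<n. (cmod (v $ k))\<^sup>2)"
  unfolding cscalar_prod_sum[OF assms] by (simp only: of_real_sum complex_norm_square)

section \<open>Reflections and extension of isometries\<close>

text \<open>
  The entries of \<open>(I - a' u u\<^sup>*)\<^sup>* (I - b' u u\<^sup>*)\<close>; the coefficients \<open>a\<close> and \<open>b\<close> absorb the factors of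
  \<open>u\<close> that do not depend on the summation index.
\<close>

lemma reflection_sum:
  fixes u :: "nat \<Rightarrow> complex"
  assumes "i < m" "j < m"
  shows "(\<Sum>k<m. ((if k = i then 1 else 0) - a * cnj (u k)) * ((if k = j then 1 else 0) - b * u k))
    = (if i = j then 1 else 0) - b * u i - a * cnj (u j) + a * b * (\<Sum>k<m. u k * cnj (u k))"
proof -
  have "(\<Sum>k<m. ((if k = i then 1 else 0) - a * cnj (u k)) * ((if k = j then 1 else 0) - b * u k))
    = (\<Sum>k<m. (if k = i then (if i = j then 1 else 0) else 0) - (if k = i then b * u i else 0)
        - (if k = j then a * cnj (u j) else 0) + a * b * (u k * cnj (u k)))"
    by (intro sum.cong) (auto simp: algebra_simps)
  then show ?thesis
    using assms by (simp add: sum.distrib sum_subtractf sum_distrib_left)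
qed

text \<open>
  With \<open>u = x - y\<close> the matrix \<open>W = I - t u u\<^sup>*\<close> fixes every vector orthogonal to \<open>u\<close>, and it maps \<open>x\<close>
  to \<open>y\<close> precisely for \<open>t = 1 / (u\<^sup>* x)\<close>. It is unitary when \<open>t + t\<^sup>* = |t|\<^sup>2 |u|\<^sup>2\<close>, that is when
  \<open>2 Re (u\<^sup>* x) = |u|\<^sup>2\<close>, and this is the equality of the norms of \<open>x\<close> and \<open>y\<close>. Allowing a complex \<open>t\<close>
  removes the usual demand that \<open>x\<^sup>* y\<close> be real.
\<close>

lemma reflection_exists:
  fixes x y :: "complex vec"
  assumes x: "x \<in> carrier_vec m" and y: "y \<in> carrier_vec m" and eq: "x \<bullet>c x = y \<bullet>c y"
  obtains W where "W \<in> carrier_mat m m" "mat_adjoint W * W = 1\<^sub>m m" "W *\<^sub>v x = y"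
    "\<And>z. z \<in> carrier_vec m \<Longrightarrow> z \<bullet>c x = z \<bullet>c y \<Longrightarrow> W *\<^sub>v z = z"
proof (cases "x = y")
  case True
  then show ?thesis using x by (intro that[of "1\<^sub>m m"]) auto
next
  case False
  define u where "u k = x $ k - y $ k" for k
  define s where "s = (\<Sum>k<m. u k * cnj (u k))"
  define r where "r = (\<Sum>k<m. x $ k * cnj (u k))"
  have s: "s = of_real (\<Sum>k<m. (cmod (u k))\<^sup>2)"
    unfolding s_def by (simp only: of_real_sum complex_norm_square)
  obtain k where k: "k < m" "u k \<noteq> 0"
    using False x y unfolding u_def by (metis carrier_vecD eq_vecI right_minus_eq)
  have "(\<Sum>k<m. (cmod (u k))\<^sup>2) > 0"
    using k by (intro sum_pos2[of _ k]) auto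
  then have s0: "s \<noteq> 0" unfolding s by (metis of_real_eq_0_iff less_irrefl)
  have eq': "(\<Sum>k<m. x $ k * cnj (x $ k)) = (\<Sum>k<m. y $ k * cnj (y $ k))"
    using eq x y by (simp add: cscalar_prod_sum)
  have "s - (r + cnj r) = (\<Sum>k<m. y $ k * cnj (y $ k)) - (\<Sum>k<m. x $ k * cnj (x $ k))"
    unfolding s_def r_def cnj_sum sum.distrib[symmetric] sum_subtractf[symmetric]
    by (intro sum.cong) (auto simp: u_def algebra_simps)
  then have rs: "r + cnj r = s" using eq' by simp
  then have r0: "r \<noteq> 0" using s0 by auto
  define t where "t = 1 / r"
  have t: "t + cnj t = cnj t * t * s"
    using r0 unfolding t_def rs[symmetric] by (simp add: field_simps)
  define W where "W = mat m m (\<lambda>(i, j). (if i = j then 1 else 0) - t * cnj (u j) * u i)"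
  have W: "W \<in> carrier_mat m m" unfolding W_def by auto
  have Wz: "W *\<^sub>v z = vec m (\<lambda>i. z $ i - t * (\<Sum>k<m. z $ k * cnj (u k)) * u i)"
    if z: "z \<in> carrier_vec m" for z
  proof (rule eq_vecI)
    fix i assume "i < dim_vec (vec m (\<lambda>i. z $ i - t * (\<Sum>k<m. z $ k * cnj (u k)) * u i))"
    then have i: "i < m" by simp
    have "(W *\<^sub>v z) $ i = (\<Sum>k<m. (if k = i then z $ i else 0) - t * (z $ k * cnj (u k)) * u i)"
      unfolding index_mult_mat_vec_sum[OF W z i] using i
      by (intro sum.cong) (auto simp: W_def algebra_simps)
    then show "(W *\<^sub>v z) $ i = vec m (\<lambda>i. z $ i - t * (\<Sum>k<m. z $ k * cnj (u k)) * u i) $ i"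
      using i by (simp add: sum_subtractf sum_distrib_left sum_distrib_right)
  qed (use W in auto)
  show ?thesis
  proof (rule that[OF W])
    show "mat_adjoint W * W = 1\<^sub>m m"
    proof (rule eq_matI)
      fix i j assume "i < dim_row (1\<^sub>m m :: complex mat)" "j < dim_col (1\<^sub>m m :: complex mat)"
      then have ij: "i < m" "j < m" by auto
      have "(mat_adjoint W * W) $$ (i, j) = (\<Sum>k<m. ((if k = i then 1 else 0) - cnj t * u i * cnj (u k))
          * ((if k = j then 1 else 0) - t * cnj (u j) * u k))"
        unfolding index_mult_mat_sum[OF mat_adjoint_carrier[OF W] W ij] using ij W
        by (intro sum.cong) (auto simp: W_def)
      also have "\<dots> = (if i = j then 1 else 0) - (t + cnj t - cnj t * t * s) * (u i * cnj (u j))"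
        unfolding reflection_sum[OF ij] s_def[symmetric] by (simp add: algebra_simps)
      finally show "(mat_adjoint W * W) $$ (i, j) = 1\<^sub>m m $$ (i, j)"
        using ij t by simp
    qed (use W in auto)
    show "W *\<^sub>v x = y"
      unfolding Wz[OF x] r_def[symmetric] t_def using x y r0 by (intro eq_vecI) (auto simp: u_def)
    show "W *\<^sub>v z = z" if z: "z \<in> carrier_vec m" and "z \<bullet>c x = z \<bullet>c y" for z
    proof -
      have "(\<Sum>k<m. z $ k * cnj (u k)) = z \<bullet>c x - z \<bullet>c y"
        unfolding cscalar_prod_sum[OF x] cscalar_prod_sum[OF y] sum_subtractf[symmetric]
        by (intro sum.cong) (auto simp: u_def algebra_simps)
      then show ?thesis unfolding Wz[OF z] using that z by (intro eq_vecI) auto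
    qed
  qed
qed

lemma cscalar_prod_isometry:
  fixes W :: "complex mat"
  assumes "W \<in> carrier_mat m m" "mat_adjoint W * W = 1\<^sub>m m" "v \<in> carrier_vec m" "w \<in> carrier_vec m"
  shows "(W *\<^sub>v v) \<bullet>c (W *\<^sub>v w) = v \<bullet>c w"
proof -
  have "(W *\<^sub>v v) \<bullet>c (W *\<^sub>v w) = v \<bullet>c (mat_adjoint W *\<^sub>v (W *\<^sub>v w))"
    using assms by (intro cscalar_prod_adjoint) auto
  also have "mat_adjoint W *\<^sub>v (W *\<^sub>v w) = (mat_adjoint W * W) *\<^sub>v w"
    using assms by (intro assoc_mult_mat_vec[symmetric]) auto
  finally show ?thesis using assms by simp
qed

lemma isometry_mult:
  fixes V W :: "complex mat"
  assumes V: "V \<in> carrier_mat m m" "mat_adjoint V * V = 1\<^sub>m m"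
    and W: "W \<in> carrier_mat m m" "mat_adjoint W * W = 1\<^sub>m m"
  shows "mat_adjoint (W * V) * (W * V) = 1\<^sub>m m"
proof -
  have "mat_adjoint (W * V) * (W * V) = mat_adjoint V * (mat_adjoint W * W) * V"
    unfolding mat_adjoint_mult[OF W(1) V(1)] using V(1) W(1)
    by (smt (verit) assoc_mult_mat mat_adjoint_carrier mult_carrier_mat)
  then show ?thesis using V W by auto
qed

text \<open>
  The vectors are matched one at a time. Once a unitary \<open>V\<close> matches the earlier ones, a reflection
  \<open>W\<close> moves \<open>V x\<^sub>c\<close> to \<open>y\<^sub>c\<close>; equality of the Gram matrices makes \<open>V x\<^sub>c - y\<^sub>c\<close> orthogonal to all
  earlier \<open>y\<^sub>a\<close>, so \<open>W\<close> leaves them in place.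
\<close>

lemma isometry_of_equal_gram:
  fixes x y :: "'a \<Rightarrow> complex vec"
  assumes "finite I" "\<And>a. a \<in> I \<Longrightarrow> x a \<in> carrier_vec m" "\<And>a. a \<in> I \<Longrightarrow> y a \<in> carrier_vec m"
    and "\<And>a b. a \<in> I \<Longrightarrow> b \<in> I \<Longrightarrow> x a \<bullet>c x b = y a \<bullet>c y b"
  shows "\<exists>W \<in> carrier_mat m m. mat_adjoint W * W = 1\<^sub>m m \<and> (\<forall>a\<in>I. W *\<^sub>v x a = y a)"
  using assms
proof (induction I rule: finite_induct)
  case empty
  then show ?case by (intro bexI[of _ "1\<^sub>m m"]) auto
next
  case (insert c I)
  then obtain V where V: "V \<in> carrier_mat m m" "mat_adjoint V * V = 1\<^sub>m m" "\<And>a. a \<in> I \<Longrightarrow> V *\<^sub>v x a = y a"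
    by (metis insertCI)
  have xc: "x c \<in> carrier_vec m" and yc: "y c \<in> carrier_vec m" using insert.prems by auto
  have "(V *\<^sub>v x c) \<bullet>c (V *\<^sub>v x c) = y c \<bullet>c y c"
    using cscalar_prod_isometry[OF V(1,2) xc xc] insert.prems(3)[of c c] by simp
  then obtain W where W: "W \<in> carrier_mat m m" "mat_adjoint W * W = 1\<^sub>m m" "W *\<^sub>v (V *\<^sub>v x c) = y c"
    "\<And>z. z \<in> carrier_vec m \<Longrightarrow> z \<bullet>c (V *\<^sub>v x c) = z \<bullet>c y c \<Longrightarrow> W *\<^sub>v z = z"
    using reflection_exists[of "V *\<^sub>v x c" m "y c"] V(1) xc yc by auto
  have "W *\<^sub>v (V *\<^sub>v x a) = y a" if a: "a \<in> insert c I" for a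
  proof (cases "a = c")
    case False
    then have aI: "a \<in> I" using a by simp
    have "y a \<bullet>c (V *\<^sub>v x c) = x a \<bullet>c x c"
      using cscalar_prod_isometry[OF V(1,2) _ xc, of "x a"] V(3)[OF aI] insert.prems(1) aI by simp
    then show ?thesis
      using insert.prems aI W(4)[of "y a"] V(3)[OF aI] by simp
  qed (use W in simp)
  moreover have "(W * V) *\<^sub>v x a = W *\<^sub>v (V *\<^sub>v x a)" if "a \<in> insert c I" for a
    using W V insert.prems(1)[OF that] by (intro assoc_mult_mat_vec) auto
  ultimately show ?case
    using isometry_mult[OF V(1,2) W(1,2)] V(1) W(1) by (intro bexI[of _ "W * V"]) auto
qed

section \<open>Diagonalization of Hermitian matrices\<close>

definition real_diag_mat :: "nat \<Rightarrow> (nat \<Rightarrow> real) \<Rightarrow> complex mat" where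
  "real_diag_mat n d = mat n n (\<lambda>(i, j). if i = j then of_real (d i) else 0)"

lemma real_diag_mat_carrier [simp, intro]: "real_diag_mat n d \<in> carrier_mat n n"
  by (simp add: real_diag_mat_def)

lemma index_mult_real_diag_adjoint:
  fixes P :: "complex mat"
  assumes P: "P \<in> carrier_mat n n" and ij: "i < n" "j < n"
  shows "(P * real_diag_mat n d * mat_adjoint P) $$ (i, j) = (\<Sum>k<n. of_real (d k) * P $$ (i, k) * cnj (P $$ (j, k)))"
proof -
  have "(P * real_diag_mat n d) $$ (i, k) = of_real (d k) * P $$ (i, k)" if k: "k < n" for k
  proof -
    have "(P * real_diag_mat n d) $$ (i, k) = (\<Sum>l<n. if l = k then of_real (d k) * P $$ (i, k) else 0)"
      unfolding index_mult_mat_sum[OF P real_diag_mat_carrier ij(1) k] using k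
      by (intro sum.cong) (auto simp: real_diag_mat_def)
    then show ?thesis using k by simp
  qed
  then show ?thesis
    using index_mult_mat_sum[OF mult_carrier_mat[OF P real_diag_mat_carrier] mat_adjoint_carrier[OF P] ij]
      P ij by (simp del: index_mult_mat(1))
qed

lemma mat_adjoint_congruence:
  fixes A :: "complex mat"
  assumes "A \<in> carrier_mat n n" "mat_adjoint A = A" "P \<in> carrier_mat m n"
  shows "mat_adjoint (P * A * mat_adjoint P) = P * A * mat_adjoint P"
proof -
  have "mat_adjoint (P * A * mat_adjoint P) = P * mat_adjoint (P * A)"
    using assms by (subst mat_adjoint_mult[of _ m n]) auto
  also have "\<dots> = P * (A * mat_adjoint P)"
    using assms by (subst mat_adjoint_mult[of _ m n]) auto
  finally show ?thesis using assms by (metis assoc_mult_mat mat_adjoint_carrier)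
qed

lemma isometry_right_inverse:
  fixes W :: "complex mat"
  assumes "W \<in> carrier_mat n n" "mat_adjoint W * W = 1\<^sub>m n"
  shows "W * mat_adjoint W = 1\<^sub>m n"
  using mat_mult_left_right_inverse[OF mat_adjoint_carrier[OF assms(1)] assms(1,2)] .

lemma mat_adjoint_four_block_diag:
  fixes A B :: "complex mat"
  assumes "A \<in> carrier_mat m m" "B \<in> carrier_mat n n"
  shows "mat_adjoint (four_block_mat A (0\<^sub>m m n) (0\<^sub>m n m) B)
    = four_block_mat (mat_adjoint A) (0\<^sub>m m n) (0\<^sub>m n m) (mat_adjoint B)"
  using assms by (intro eq_matI) (auto simp: index_mat_four_block)

lemma mult_four_block_diag:
  fixes A B C D :: "complex mat"
  assumes "A \<in> carrier_mat m m" "B \<in> carrier_mat n n" "C \<in> carrier_mat m m" "D \<in> carrier_mat n n"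
  shows "four_block_mat A (0\<^sub>m m n) (0\<^sub>m n m) B * four_block_mat C (0\<^sub>m m n) (0\<^sub>m n m) D
    = four_block_mat (A * C) (0\<^sub>m m n) (0\<^sub>m n m) (B * D)"
  using assms by (subst mult_four_block_mat[of _ m m _ n _ n _ _ m _ n]) auto

text \<open>
  A reflection \<open>W\<close> carries a multiple of the first unit vector to an eigenvector, so
  \<open>W\<^sup>* A W\<close> has first column \<open>(\<lambda>, 0, \<dots>, 0)\<close>, and by symmetry the same first row. The
  remaining block is Hermitian of smaller size.
\<close>

lemma hermitian_diagonalization:
  fixes A :: "complex mat"
  assumes "A \<in> carrier_mat n n" "mat_adjoint A = A"
  shows "\<exists>P \<in> carrier_mat n n. \<exists>d. mat_adjoint P * P = 1\<^sub>m n \<and> A = P * real_diag_mat n d * mat_adjoint P"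
  using assms
proof (induction n arbitrary: A)
  case 0
  show ?case using 0 by (intro bexI[of _ "1\<^sub>m 0"] exI[of _ "\<lambda>_. 0"]) (auto intro!: eq_matI)
next
  case (Suc n)
  note A = Suc.prems(1)
  obtain as where "char_poly A = (\<Prod>a\<leftarrow>as. [:- a, 1:])" "length as = Suc n"
    using char_poly_factorized[OF A] by blast
  then have "poly (char_poly A) (hd as) = 0"
    by (cases as) (auto simp: poly_prod_list)
  then obtain v where v: "v \<in> carrier_vec (Suc n)" "v \<noteq> 0\<^sub>v (Suc n)" "A *\<^sub>v v = hd as \<cdot>\<^sub>v v"
    using A unfolding eigenvalue_root_char_poly[OF A, symmetric] eigenvalue_def eigenvector_def by auto
  define l where "l = hd as"
  \<comment> \<open>the reflection needs vectors of equal length, so the unit vector is scaled by \<open>r = |v|\<close>\<close>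
  define r where "r = sqrt (\<Sum>k<Suc n. (cmod (v $ k))\<^sup>2)"
  obtain k where "k < Suc n" "v $ k \<noteq> 0"
    using v(1,2) by (metis carrier_vecD eq_vecI index_zero_vec(1) index_zero_vec(2))
  then have "(\<Sum>k<Suc n. (cmod (v $ k))\<^sup>2) > 0"
    by (intro sum_pos2[of _ k]) auto
  then have r: "r > 0" "r\<^sup>2 = (\<Sum>k<Suc n. (cmod (v $ k))\<^sup>2)"
    unfolding r_def by auto
  define x where "x = of_real r \<cdot>\<^sub>v (unit_vec (Suc n) 0 :: complex vec)"
  have x: "x \<in> carrier_vec (Suc n)" unfolding x_def by auto
  have "x \<bullet>c x = of_real (\<Sum>k<Suc n. if k = 0 then r\<^sup>2 else 0)"
    unfolding cscalar_prod_self[OF x] using r(1)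
    by (intro arg_cong[of _ _ of_real] sum.cong) (auto simp: x_def norm_mult)
  also have "\<dots> = v \<bullet>c v"
    unfolding cscalar_prod_self[OF v(1)] r(2)[symmetric] by simp
  finally obtain W where W: "W \<in> carrier_mat (Suc n) (Suc n)" "mat_adjoint W * W = 1\<^sub>m (Suc n)" "W *\<^sub>v x = v"
    using reflection_exists[OF x v(1)] by blast
  note Wa = mat_adjoint_carrier[OF W(1)]
  define B where "B = mat_adjoint W * A * W"
  have B: "B \<in> carrier_mat (Suc n) (Suc n)" unfolding B_def using A W by auto
  have BH: "mat_adjoint B = B"
    using mat_adjoint_congruence[OF A Suc.prems(2) Wa] unfolding B_def by simp
  have AB: "A = W * B * mat_adjoint W"
  proof -
    have "W * B * mat_adjoint W = (W * mat_adjoint W) * A * (W * mat_adjoint W)"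
      unfolding B_def using A W(1) Wa
      by (smt (verit) assoc_mult_mat mult_carrier_mat)
    then show ?thesis using isometry_right_inverse[OF W(1,2)] A by simp
  qed
  have "B *\<^sub>v x = mat_adjoint W *\<^sub>v (A *\<^sub>v (W *\<^sub>v x))"
    unfolding B_def using A W(1) Wa x
    by (smt (verit) assoc_mult_mat_vec mult_carrier_mat mult_mat_vec_carrier)
  also have "\<dots> = l \<cdot>\<^sub>v (mat_adjoint W *\<^sub>v (W *\<^sub>v x))"
    unfolding W(3) v(3) l_def using Wa v(1) by (intro mult_mat_vec)
  also have "mat_adjoint W *\<^sub>v (W *\<^sub>v x) = x"
    using assoc_mult_mat_vec[OF Wa W(1) x] W(2) x by simp
  finally have Bx: "B *\<^sub>v x = l \<cdot>\<^sub>v x" .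
  have Bi0: "B $$ (i, 0) = (if i = 0 then l else 0)" if i: "i < Suc n" for i
  proof -
    have "(B *\<^sub>v x) $ i = (\<Sum>k<Suc n. if k = 0 then of_real r * B $$ (i, 0) else 0)"
      unfolding index_mult_mat_vec_sum[OF B x i] by (intro sum.cong) (auto simp: x_def)
    then have "of_real r * B $$ (i, 0) = l * x $ i"
      unfolding Bx using i x by simp
    then show ?thesis using i r(1) by (auto simp: x_def)
  qed
  have B0i: "B $$ (0, i) = (if i = 0 then l else 0)" if i: "i < Suc n" for i
    using arg_cong[OF BH, of "\<lambda>M. M $$ (i, 0)"] arg_cong[OF BH, of "\<lambda>M. M $$ (0, i)"] i B Bi0
    by (auto simp: Bi0)
  have l: "l = of_real (Re l)"
    using arg_cong[OF BH, of "\<lambda>M. M $$ (0, 0)"] B Bi0[of 0]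
    by (simp add: complex_eq_iff)
  define A' where "A' = mat n n (\<lambda>(i, j). B $$ (Suc i, Suc j))"
  have A': "A' \<in> carrier_mat n n" unfolding A'_def by simp
  have "mat_adjoint A' = A'"
  proof (rule eq_matI)
    fix i j assume "i < dim_row A'" "j < dim_col A'"
    then have ij: "i < n" "j < n" using A' by auto
    then show "mat_adjoint A' $$ (i, j) = A' $$ (i, j)"
      using arg_cong[OF BH, of "\<lambda>M. M $$ (Suc i, Suc j)"] B unfolding A'_def by simp
  qed (use A' in auto)
  then obtain P d where P: "P \<in> carrier_mat n n" "mat_adjoint P * P = 1\<^sub>m n"
    and A'P: "A' = P * real_diag_mat n d * mat_adjoint P"
    using Suc.IH[OF A'] by blast
  define l1 where "l1 = real_diag_mat 1 (\<lambda>_. Re l)"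
  define F where "F = four_block_mat (1\<^sub>m 1) (0\<^sub>m 1 n) (0\<^sub>m n 1) P"
  define e where "e i = (if i = 0 then Re l else d (i - 1))" for i
  have D: "real_diag_mat (Suc n) e = four_block_mat l1 (0\<^sub>m 1 n) (0\<^sub>m n 1) (real_diag_mat n d)"
    by (intro eq_matI) (auto simp: real_diag_mat_def l1_def e_def)
  have F: "F \<in> carrier_mat (Suc n) (Suc n)" unfolding F_def using P by auto
  have Fa: "mat_adjoint F = four_block_mat (1\<^sub>m 1) (0\<^sub>m 1 n) (0\<^sub>m n 1) (mat_adjoint P)"
    unfolding F_def using P by (subst mat_adjoint_four_block_diag) auto
  have "mat_adjoint F * F = four_block_mat (1\<^sub>m 1) (0\<^sub>m 1 n) (0\<^sub>m n 1) (1\<^sub>m n)"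
    unfolding Fa unfolding F_def using P by (subst mult_four_block_diag) auto
  then have FF: "mat_adjoint F * F = 1\<^sub>m (Suc n)" by simp
  have "B = four_block_mat l1 (0\<^sub>m 1 n) (0\<^sub>m n 1) A'"
    using B Bi0 B0i l by (intro eq_matI) (auto simp: l1_def real_diag_mat_def A'_def)
  also have "\<dots> = F * real_diag_mat (Suc n) e * mat_adjoint F"
  proof -
    have l1: "l1 \<in> carrier_mat 1 1" unfolding l1_def by (rule real_diag_mat_carrier)
    have "F * real_diag_mat (Suc n) e = four_block_mat l1 (0\<^sub>m 1 n) (0\<^sub>m n 1) (P * real_diag_mat n d)"
      unfolding D F_def using mult_four_block_diag[OF one_carrier_mat P(1) l1 real_diag_mat_carrier] l1 by simp
    then show ?thesis
      unfolding Fa A'P using mult_four_block_diag[OF l1 mult_carrier_mat[OF P(1) real_diag_mat_carrier]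
        one_carrier_mat mat_adjoint_carrier[OF P(1)]] l1 by simp
  qed
  finally have BF: "B = F * real_diag_mat (Suc n) e * mat_adjoint F" .
  have "A = (W * F) * real_diag_mat (Suc n) e * mat_adjoint (W * F)"
    unfolding AB BF mat_adjoint_mult[OF W(1) F] using W(1) F Wa mat_adjoint_carrier[OF F]
      real_diag_mat_carrier[of "Suc n" e]
    by (smt (verit) assoc_mult_mat mult_carrier_mat)
  then show ?case
    using isometry_mult[OF F FF W(1,2)] W(1) F by (intro bexI[of _ "W * F"]) auto
qed

section \<open>Quadratic forms and Gram matrices\<close>

lemma quadratic_form_sum:
  fixes A :: "complex mat"
  assumes "A \<in> carrier_mat n n" "v \<in> carrier_vec n"
  shows "(A *\<^sub>v v) \<bullet>c v = (\<Sum>i<n. \<Sum>j<n. A $$ (i, j) * v $ j * cnj (v $ i))"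
  using assms by (simp add: cscalar_prod_sum index_mult_mat_vec_sum sum_distrib_right del: index_mult_mat_vec)

lemma quadratic_form_congruence:
  fixes A P :: "complex mat"
  assumes A: "A \<in> carrier_mat n n" and P: "P \<in> carrier_mat m n" and v: "v \<in> carrier_vec m"
  shows "((P * A * mat_adjoint P) *\<^sub>v v) \<bullet>c v = (A *\<^sub>v (mat_adjoint P *\<^sub>v v)) \<bullet>c (mat_adjoint P *\<^sub>v v)"
proof -
  have w: "mat_adjoint P *\<^sub>v v \<in> carrier_vec n"
    using mult_mat_vec_carrier[OF mat_adjoint_carrier[OF P] v] .
  have "(P * A * mat_adjoint P) *\<^sub>v v = P *\<^sub>v (A *\<^sub>v (mat_adjoint P *\<^sub>v v))"
    unfolding assoc_mult_mat_vec[OF mult_carrier_mat[OF P A] mat_adjoint_carrier[OF P] v]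
    by (rule assoc_mult_mat_vec[OF P A w])
  then show ?thesis
    using cscalar_prod_adjoint[OF P _ v, of "A *\<^sub>v (mat_adjoint P *\<^sub>v v)"] A w by simp
qed

lemma quadratic_form_real_diag:
  assumes w: "w \<in> carrier_vec n"
  shows "(real_diag_mat n d *\<^sub>v w) \<bullet>c w = of_real (\<Sum>k<n. d k * (cmod (w $ k))\<^sup>2)"
proof -
  have "(real_diag_mat n d *\<^sub>v w) $ k = of_real (d k) * w $ k" if k: "k < n" for k
  proof -
    have "(real_diag_mat n d *\<^sub>v w) $ k = (\<Sum>l<n. if l = k then of_real (d k) * w $ k else 0)"
      unfolding index_mult_mat_vec_sum[OF real_diag_mat_carrier w k] using k
      by (intro sum.cong) (auto simp: real_diag_mat_def)
    then show ?thesis using k by simp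
  qed
  then have "(real_diag_mat n d *\<^sub>v w) \<bullet>c w = (\<Sum>k<n. of_real (d k) * (w $ k * cnj (w $ k)))"
    unfolding cscalar_prod_sum[OF w] by (intro sum.cong) auto
  then show ?thesis by (simp only: of_real_sum of_real_mult complex_norm_square)
qed

text \<open>
  Absorbing square roots of the diagonal entries into \<open>P\<close>: with \<open>s = 1\<close> this turns a
  diagonalization of a positive semidefinite matrix into a Gram factorization, with \<open>s = \<plusminus>1\<close> it
  turns one of a Hermitian matrix into a congruence with a signature matrix.
\<close>

lemma real_diag_rescale:
  fixes P :: "complex mat"
  assumes P: "P \<in> carrier_mat n n" and d: "\<And>k. k < n \<Longrightarrow> d k = s k * (a k)\<^sup>2"
  shows "P * real_diag_mat n d * mat_adjoint P
    = (P * real_diag_mat n a) * real_diag_mat n s * mat_adjoint (P * real_diag_mat n a)"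
proof (rule eq_matI)
  let ?Q = "P * real_diag_mat n a"
  fix i j assume "i < dim_row (?Q * real_diag_mat n s * mat_adjoint ?Q)"
    "j < dim_col (?Q * real_diag_mat n s * mat_adjoint ?Q)"
  then have ij: "i < n" "j < n" using P by auto
  have Q: "?Q $$ (i, k) = of_real (a k) * P $$ (i, k)" if i: "i < n" and k: "k < n" for i k
  proof -
    have "?Q $$ (i, k) = (\<Sum>l<n. if l = k then of_real (a k) * P $$ (i, k) else 0)"
      unfolding index_mult_mat_sum[OF P real_diag_mat_carrier i k] using k
      by (intro sum.cong) (auto simp: real_diag_mat_def)
    then show ?thesis using k by simp
  qed
  show "(P * real_diag_mat n d * mat_adjoint P) $$ (i, j) = (?Q * real_diag_mat n s * mat_adjoint ?Q) $$ (i, j)"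
    unfolding index_mult_real_diag_adjoint[OF P ij]
      index_mult_real_diag_adjoint[OF mult_carrier_mat[OF P real_diag_mat_carrier] ij]
    using ij by (intro sum.cong) (auto simp: Q d power2_eq_square simp del: index_mult_mat(1))
qed (use P in auto)

lemma real_diag_one: "real_diag_mat n (\<lambda>_. 1) = 1\<^sub>m n"
  by (intro eq_matI) (auto simp: real_diag_mat_def)

lemma quadratic_form_gram:
  fixes Y :: "complex mat"
  assumes "Y \<in> carrier_mat n m" "v \<in> carrier_vec n"
  shows "((Y * mat_adjoint Y) *\<^sub>v v) \<bullet>c v = of_real (\<Sum>k<m. (cmod ((mat_adjoint Y *\<^sub>v v) $ k))\<^sup>2)"
proof -
  have w: "mat_adjoint Y *\<^sub>v v \<in> carrier_vec m"
    using mult_mat_vec_carrier[OF mat_adjoint_carrier[OF assms(1)] assms(2)] .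
  have "((Y * 1\<^sub>m m * mat_adjoint Y) *\<^sub>v v) \<bullet>c v = (mat_adjoint Y *\<^sub>v v) \<bullet>c (mat_adjoint Y *\<^sub>v v)"
    unfolding quadratic_form_congruence[OF one_carrier_mat assms] using w by simp
  then show ?thesis
    unfolding right_mult_one_mat[OF assms(1)] cscalar_prod_self[OF w] .
qed

text \<open>
  The factor is square. This is what makes matrices of size \<open>m \<le> n\<close> sufficient for unitary zeros.
\<close>

lemma psd_factorization:
  fixes A :: "complex mat"
  assumes A: "A \<in> carrier_mat n n" "mat_adjoint A = A"
    and psd: "\<And>v. v \<in> carrier_vec n \<Longrightarrow> Re ((A *\<^sub>v v) \<bullet>c v) \<ge> 0"
  obtains Y where "Y \<in> carrier_mat n n" "A = Y * mat_adjoint Y"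
proof -
  obtain P d where P: "P \<in> carrier_mat n n" "mat_adjoint P * P = 1\<^sub>m n"
    and AP: "A = P * real_diag_mat n d * mat_adjoint P"
    using hermitian_diagonalization[OF A] by blast
  have d: "d k \<ge> 0" if k: "k < n" for k
  proof -
    have e: "unit_vec n k \<in> carrier_vec n" by simp
    define v where "v = P *\<^sub>v unit_vec n k"
    have v: "v \<in> carrier_vec n" unfolding v_def using P by auto
    have "mat_adjoint P *\<^sub>v v = unit_vec n k"
      unfolding v_def assoc_mult_mat_vec[OF mat_adjoint_carrier[OF P(1)] P(1) e, symmetric] P(2)
      using e by simp
    then have "Re ((A *\<^sub>v v) \<bullet>c v) = (\<Sum>l<n. d l * (cmod (unit_vec n k $ l))\<^sup>2)"
      unfolding AP quadratic_form_congruence[OF real_diag_mat_carrier P(1) v]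
      using quadratic_form_real_diag[OF e, of d] by simp
    also have "\<dots> = (\<Sum>l<n. if l = k then d k else 0)"
      using k by (intro sum.cong) auto
    finally show ?thesis using psd[OF v] k by simp
  qed
  have "P * real_diag_mat n d * mat_adjoint P = (P * real_diag_mat n (\<lambda>k. sqrt (d k))) * real_diag_mat n (\<lambda>_. 1)
      * mat_adjoint (P * real_diag_mat n (\<lambda>k. sqrt (d k)))"
    using d by (intro real_diag_rescale P(1)) auto
  then show ?thesis
    unfolding AP[symmetric] real_diag_one right_mult_one_mat[OF mult_carrier_mat[OF P(1) real_diag_mat_carrier]]
    by (rule that[OF mult_carrier_mat[OF P(1) real_diag_mat_carrier]])
qed

lemma gram_hermitian:
  fixes Y :: "complex mat"
  assumes "Y \<in> carrier_mat n m"
  shows "mat_adjoint (Y * mat_adjoint Y) = Y * mat_adjoint Y"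
  using mat_adjoint_mult[OF assms mat_adjoint_carrier[OF assms]] by simp

text \<open>
  The obvious factor of a convex combination is the wide matrix \<open>[\<surd>(1-t) Y, \<surd>t Z]\<close>; the
  factorization of positive semidefinite matrices replaces it by a square one.
\<close>

lemma gram_convex:
  fixes Y Z :: "complex mat"
  assumes Y: "Y \<in> carrier_mat n l" and Z: "Z \<in> carrier_mat n m" and t: "0 \<le> t" "t \<le> 1"
  obtains X where "X \<in> carrier_mat n n"
    "X * mat_adjoint X = of_real (1 - t) \<cdot>\<^sub>m (Y * mat_adjoint Y) + of_real t \<cdot>\<^sub>m (Z * mat_adjoint Z)"
proof -
  define A where "A = of_real (1 - t) \<cdot>\<^sub>m (Y * mat_adjoint Y) + of_real t \<cdot>\<^sub>m (Z * mat_adjoint Z)"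
  have YY: "Y * mat_adjoint Y \<in> carrier_mat n n" and ZZ: "Z * mat_adjoint Z \<in> carrier_mat n n"
    using Y Z by auto
  have A: "A \<in> carrier_mat n n" unfolding A_def using YY ZZ by auto
  have entry: "A $$ (a, b) = of_real (1 - t) * (Y * mat_adjoint Y) $$ (a, b) + of_real t * (Z * mat_adjoint Z) $$ (a, b)"
    if "a < n" "b < n" for a b
    unfolding A_def using that YY ZZ Y Z by (simp del: index_mult_mat(1))
  have "mat_adjoint A = A"
  proof (rule eq_matI)
    fix i j assume "i < dim_row A" "j < dim_col A"
    then have ij: "i < n" "j < n" using A by auto
    have "cnj ((Y * mat_adjoint Y) $$ (j, i)) = (Y * mat_adjoint Y) $$ (i, j)"
      "cnj ((Z * mat_adjoint Z) $$ (j, i)) = (Z * mat_adjoint Z) $$ (i, j)"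
      using index_mat_adjoint[of i "Y * mat_adjoint Y" j] index_mat_adjoint[of i "Z * mat_adjoint Z" j]
        gram_hermitian[OF Y] gram_hermitian[OF Z] YY ZZ ij by (metis carrier_matD)+
    then show "mat_adjoint A $$ (i, j) = A $$ (i, j)"
      using ij A entry by (simp del: index_mult_mat(1))
  qed (use A in auto)
  moreover have "Re ((A *\<^sub>v v) \<bullet>c v) \<ge> 0" if v: "v \<in> carrier_vec n" for v
  proof -
    have "(A *\<^sub>v v) \<bullet>c v = of_real (1 - t) * (((Y * mat_adjoint Y) *\<^sub>v v) \<bullet>c v)
        + of_real t * (((Z * mat_adjoint Z) *\<^sub>v v) \<bullet>c v)"
      unfolding quadratic_form_sum[OF A v] quadratic_form_sum[OF YY v] quadratic_form_sum[OF ZZ v]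
        sum_distrib_left sum.distrib[symmetric]
      by (intro sum.cong) (simp_all only: entry lessThan_iff algebra_simps)
    then show ?thesis
      unfolding quadratic_form_gram[OF Y v] quadratic_form_gram[OF Z v]
      using t by (simp add: sum_nonneg)
  qed
  ultimately obtain X where X: "X \<in> carrier_mat n n" "A = X * mat_adjoint X"
    using psd_factorization[OF A] by blast
  show ?thesis
    by (rule that[OF X(1) X(2)[unfolded A_def, symmetric]])
qed

section \<open>Entries of block diagonal matrices\<close>

text \<open>
  An index of a block diagonal matrix with block sizes \<open>ns\<close> is decomposed as
  \<open>block_offset ns j + a\<close> with \<open>a < ns j\<close>. Here \<open>j\<close> and \<open>a\<close> are recovered by \<open>block_of\<close> and
  \<open>pos_in_block\<close>, whose values are meaningful only for indices that lie below some offset.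
\<close>

definition block_offset :: "(nat \<Rightarrow> nat) \<Rightarrow> nat \<Rightarrow> nat" where
  "block_offset ns j = (\<Sum>l<j. ns l)"

definition block_of :: "(nat \<Rightarrow> nat) \<Rightarrow> nat \<Rightarrow> nat" where
  "block_of ns i = (LEAST j. i < block_offset ns (Suc j))"

definition pos_in_block :: "(nat \<Rightarrow> nat) \<Rightarrow> nat \<Rightarrow> nat" where
  "pos_in_block ns i = i - block_offset ns (block_of ns i)"

lemma block_offset_Suc [simp]: "block_offset ns (Suc j) = block_offset ns j + ns j"
  by (simp add: block_offset_def)

lemma block_offset_0 [simp]: "block_offset ns 0 = 0"
  by (simp add: block_offset_def)

lemma block_offset_mono: "j \<le> l \<Longrightarrow> block_offset ns j \<le> block_offset ns l"
  unfolding block_offset_def by (intro sum_mono2) auto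

lemma block_of_offset [simp]:
  assumes "a < ns j"
  shows "block_of ns (block_offset ns j + a) = j"
  unfolding block_of_def
proof (rule Least_equality)
  fix l assume "block_offset ns j + a < block_offset ns (Suc l)"
  then show "j \<le> l"
    using block_offset_mono[of "Suc l" j ns] by (meson le_add1 le_less_trans not_less not_less_eq_eq)
qed (use assms in simp)

lemma pos_in_block_offset [simp]: "a < ns j \<Longrightarrow> pos_in_block ns (block_offset ns j + a) = a"
  by (simp add: pos_in_block_def)

lemma block_index_cases:
  assumes "i < block_offset ns d"
  obtains j a where "j < d" "a < ns j" "i = block_offset ns j + a"
  using assms
proof (induction d arbitrary: thesis)
  case (Suc d)
  show ?case
  proof (cases "i < block_offset ns d")
    case True
    then show ?thesis using Suc.IH Suc.prems(1) less_SucI by metis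
  next
    case False
    then show ?thesis using Suc.prems(1)[of d "i - block_offset ns d"] Suc.prems(2) by auto
  qed
qed simp

lemma block_offset_less:
  assumes "j < d" "a < ns j"
  shows "block_offset ns j + a < block_offset ns d"
  using block_offset_mono[of "Suc j" d ns] assms by simp

lemma block_of_less: "i < block_offset ns d \<Longrightarrow> block_of ns i < d"
  by (elim block_index_cases) simp

lemma pos_in_block_less: "i < block_offset ns d \<Longrightarrow> pos_in_block ns i < ns (block_of ns i)"
  by (elim block_index_cases) simp

lemma offset_pos_in_block: "i < block_offset ns d \<Longrightarrow> block_offset ns (block_of ns i) + pos_in_block ns i = i"
  by (elim block_index_cases) simp

lemma sum_block:
  fixes f :: "nat \<Rightarrow> 'a :: comm_monoid_add"
  assumes "j < d"
  shows "(\<Sum>i<block_offset ns d. if block_of ns i = j then f i else 0) = (\<Sum>a<ns j. f (block_offset ns j + a))"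
proof -
  have "(\<Sum>i<block_offset ns d. if block_of ns i = j then f i else 0)
      = (\<Sum>i \<in> {i. i < block_offset ns d \<and> block_of ns i = j}. f i)"
    by (intro sum.mono_neutral_cong_right) auto
  also have "\<dots> = (\<Sum>a<ns j. f (block_offset ns j + a))"
    by (rule sum.reindex_bij_witness[of _ "\<lambda>a. block_offset ns j + a" "pos_in_block ns"])
      (auto simp: offset_pos_in_block pos_in_block_less block_offset_less[OF assms] elim!: block_index_cases)
  finally show ?thesis .
qed

lemma direct_sum_mat_Suc:
  "direct_sum_mat (Suc d) A = four_block_mat (direct_sum_mat d A)
    (0\<^sub>m (dim_row (direct_sum_mat d A)) (dim_col (A d))) (0\<^sub>m (dim_row (A d)) (dim_col (direct_sum_mat d A))) (A d)"
  unfolding direct_sum_mat_def by (simp add: diag_block_mat_last Let_def)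

lemma direct_sum_mat_carrier:
  "(\<And>j. j < d \<Longrightarrow> A j \<in> carrier_mat (ns j) (ns j)) \<Longrightarrow>
    direct_sum_mat d A \<in> carrier_mat (block_offset ns d) (block_offset ns d)"
proof (induction d)
  case 0
  then show ?case by (simp add: direct_sum_mat_def)
next
  case (Suc d)
  have "direct_sum_mat d A \<in> carrier_mat (block_offset ns d) (block_offset ns d)"
    using Suc by simp
  then show ?case unfolding direct_sum_mat_Suc using Suc.prems[of d] by auto
qed

lemma index_direct_sum_mat:
  "(\<And>j. j < d \<Longrightarrow> A j \<in> carrier_mat (ns j) (ns j)) \<Longrightarrow> i < block_offset ns d \<Longrightarrow> k < block_offset ns d \<Longrightarrow>
    direct_sum_mat d A $$ (i, k) = (if block_of ns i = block_of ns k
      then A (block_of ns i) $$ (pos_in_block ns i, pos_in_block ns k) else 0)"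
proof (induction d)
  case (Suc d)
  have D: "direct_sum_mat d A \<in> carrier_mat (block_offset ns d) (block_offset ns d)"
    using Suc.prems by (intro direct_sum_mat_carrier) simp
  have Ad: "A d \<in> carrier_mat (ns d) (ns d)" using Suc.prems by simp
  have *: "block_of ns l = d \<and> pos_in_block ns l = l - block_offset ns d"
    if "\<not> l < block_offset ns d" "l < block_offset ns (Suc d)" for l
    using that block_of_offset[of "l - block_offset ns d" ns d]
      pos_in_block_offset[of "l - block_offset ns d" ns d] by auto
  have **: "block_of ns l \<noteq> d" if "l < block_offset ns d" for l
    using block_of_less[OF that] by simp
  show ?case
    unfolding direct_sum_mat_Suc
    using Suc.prems(2,3) D Ad Suc.IH[OF Suc.prems(1)] *[of i] *[of k] **[of i] **[of k]
    by (cases "i < block_offset ns d"; cases "k < block_offset ns d") (auto simp: index_mat_four_block)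
qed simp

section \<open>Separation of the block defects from zero\<close>

text \<open>
  If \<open>a\<close> is the point of least norm on the segment from \<open>a\<close> to \<open>b\<close>, then the directional
  derivative of the squared norm at \<open>a\<close> is nonnegative, which says \<open>\<langle>a, b\<rangle> \<ge> |a|\<^sup>2\<close>.
\<close>

lemma first_order_optimality:
  fixes a b :: "'i \<Rightarrow> complex"
  assumes min: "\<And>t. 0 < t \<Longrightarrow> t \<le> 1 \<Longrightarrow>
    (\<Sum>i\<in>I. (cmod (a i))\<^sup>2) \<le> (\<Sum>i\<in>I. (cmod (of_real (1 - t) * a i + of_real t * b i))\<^sup>2)"
  shows "(\<Sum>i\<in>I. (cmod (a i))\<^sup>2) \<le> Re (\<Sum>i\<in>I. a i * cnj (b i))"
proof (rule ccontr)
  define A where "A = (\<Sum>i\<in>I. (cmod (a i))\<^sup>2)"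
  define B where "B = (\<Sum>i\<in>I. (cmod (b i))\<^sup>2)"
  define R where "R = Re (\<Sum>i\<in>I. a i * cnj (b i))"
  define q where "q = A - 2 * R + B"
  assume "\<not> ?thesis"
  then have AR: "A > R" by (simp add: A_def R_def)
  \<comment> \<open>small enough that the quadratic term \<open>t q\<close> cannot compensate the linear one\<close>
  define t where "t = min 1 ((A - R) / (\<bar>q\<bar> + 1))"
  have "t \<le> (A - R) / (\<bar>q\<bar> + 1)" by (simp add: t_def)
  then have "t * (\<bar>q\<bar> + 1) \<le> A - R" by (simp add: pos_le_divide_eq)
  with AR have t: "0 < t" "t \<le> 1" "t * (\<bar>q\<bar> + 1) \<le> A - R"
    by (auto simp: t_def)
  have "(cmod (of_real (1 - t) * x + of_real t * y))\<^sup>2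
      = (1 - t)\<^sup>2 * (cmod x)\<^sup>2 + t\<^sup>2 * (cmod y)\<^sup>2 + 2 * t * (1 - t) * Re (x * cnj y)" for x y
    unfolding cmod_power2 by (simp add: power2_eq_square algebra_simps)
  then have "A \<le> (1 - t)\<^sup>2 * A + t\<^sup>2 * B + 2 * t * (1 - t) * R"
    using min[OF t(1,2)] by (simp only: A_def B_def R_def Re_sum sum.distrib sum_distrib_left)
  then have "t * (2 * (A - R)) \<le> t * (t * q)"
    by (simp add: q_def power2_eq_square algebra_simps)
  then have "2 * (A - R) \<le> t * q" using t(1) by simp
  also have "\<dots> \<le> t * (\<bar>q\<bar> + 1)" using t(1) by (intro mult_left_mono) auto
  finally show False using t(3) AR by simp
qed

text \<open>
  Vectors are functions that vanish off a finite index set, so that compactness can be taken in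
  the product topology: the sphere is a closed subset of a product of compact sets.
\<close>

lemma compact_unit_sphere:
  assumes "finite (I :: 'i set)"
  shows "compact {y :: 'i \<Rightarrow> complex. (\<forall>i. i \<notin> I \<longrightarrow> y i = 0) \<and> (\<Sum>i\<in>I. (cmod (y i))\<^sup>2) = 1}"
proof -
  \<comment> \<open>a compact square that contains the closed unit disc\<close>
  define B where "B = (\<lambda>p. Complex (fst p) (snd p)) ` ({-1..1} \<times> {-1..1})"
  have "continuous_on ({-1..1} \<times> {-1..1}) (\<lambda>p :: real \<times> real. Complex (fst p) (snd p))"
    unfolding continuous_on_def by (intro ballI tendsto_Complex tendsto_fst tendsto_snd tendsto_ident_at)
  then have B: "compact B"
    unfolding B_def by (intro compact_continuous_image compact_Times compact_Icc)
  have unit_disc: "z \<in> B" if "cmod z \<le> 1" for z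
    unfolding B_def using abs_Re_le_cmod[of z] abs_Im_le_cmod[of z] that
    by (intro image_eqI[of _ _ "(Re z, Im z)"]) auto
  define T :: "'i \<Rightarrow> complex set" where "T i = (if i \<in> I then B else {0})" for i
  have "compactin (product_topology (\<lambda>i. euclidean) UNIV) (PiE UNIV T)"
    unfolding compactin_PiE using B by (auto simp: T_def)
  then have T: "compact (PiE UNIV T)"
    by (simp add: euclidean_product_topology)
  have "closed {y :: 'i \<Rightarrow> complex. (\<Sum>i\<in>I. (cmod (y i))\<^sup>2) = 1}"
    by (intro closed_Collect_eq continuous_intros continuous_on_product_coordinates)
  then have "compact (PiE UNIV T \<inter> {y. (\<Sum>i\<in>I. (cmod (y i))\<^sup>2) = 1})"
    by (rule compact_Int_closed[OF T])
  also have "PiE UNIV T \<inter> {y. (\<Sum>i\<in>I. (cmod (y i))\<^sup>2) = 1}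
      = {y. (\<forall>i. i \<notin> I \<longrightarrow> y i = 0) \<and> (\<Sum>i\<in>I. (cmod (y i))\<^sup>2) = 1}" (is "?L = ?R")
  proof
    show "?L \<subseteq> ?R" by (auto simp: T_def PiE_iff split: if_splits)
    show "?R \<subseteq> ?L"
    proof
      fix y assume y: "y \<in> ?R"
      have "cmod (y i) \<le> 1" if "i \<in> I" for i
      proof -
        have "(cmod (y i))\<^sup>2 \<le> (\<Sum>i\<in>I. (cmod (y i))\<^sup>2)"
          using assms that by (intro member_le_sum) auto
        then show ?thesis using y by (auto simp add: power2_le_iff_abs_le[of 1, simplified] abs_le_square_iff[of _ 1, simplified, symmetric])
      qed
      then show "y \<in> ?L" using y unit_disc by (auto simp: T_def PiE_iff)
    qed
  qed
  finally show ?thesis .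
qed

lemma quadratic_form_smult:
  fixes A :: "complex mat"
  assumes A: "A \<in> carrier_mat n n" and v: "v \<in> carrier_vec n"
  shows "(A *\<^sub>v (c \<cdot>\<^sub>v v)) \<bullet>c (c \<cdot>\<^sub>v v) = of_real ((cmod c)\<^sup>2) * ((A *\<^sub>v v) \<bullet>c v)"
  unfolding quadratic_form_sum[OF A v] quadratic_form_sum[OF A smult_carrier_vec[THEN iffD2, OF v]]
    sum_distrib_left complex_norm_square
  using v by (intro sum.cong) (auto simp: algebra_simps)

lemma index_gram:
  fixes Y :: "complex mat"
  assumes "Y \<in> carrier_mat n m" "k < n" "l < n"
  shows "(Y * mat_adjoint Y) $$ (k, l) = (\<Sum>t<m. Y $$ (k, t) * cnj (Y $$ (l, t)))"
  using index_mult_mat_sum[OF assms(1) mat_adjoint_carrier[OF assms(1)] assms(2,3)] assms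
  by (simp del: index_mult_mat(1))

lemma index_gram_mult:
  fixes A Y :: "complex mat"
  assumes A: "A \<in> carrier_mat r n" and Y: "Y \<in> carrier_mat n m" and kl: "k < r" "l < r"
  shows "(A * Y * mat_adjoint (A * Y)) $$ (k, l)
    = (\<Sum>a<n. \<Sum>b<n. A $$ (k, a) * cnj (A $$ (l, b)) * (Y * mat_adjoint Y) $$ (a, b))"
proof -
  have "(A * Y * mat_adjoint (A * Y)) $$ (k, l)
      = (\<Sum>t<m. (\<Sum>a<n. A $$ (k, a) * Y $$ (a, t)) * (\<Sum>b<n. cnj (A $$ (l, b)) * cnj (Y $$ (b, t))))"
    unfolding index_gram[OF mult_carrier_mat[OF A Y] kl]
    by (intro sum.cong) (simp_all add: index_mult_mat_sum[OF A Y] kl del: index_mult_mat(1))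
  also have "\<dots> = (\<Sum>t<m. \<Sum>a<n. \<Sum>b<n. A $$ (k, a) * cnj (A $$ (l, b)) * (Y $$ (a, t) * cnj (Y $$ (b, t))))"
    unfolding sum_product by (intro sum.cong) (auto simp: algebra_simps)
  also have "\<dots> = (\<Sum>a<n. \<Sum>t<m. \<Sum>b<n. A $$ (k, a) * cnj (A $$ (l, b)) * (Y $$ (a, t) * cnj (Y $$ (b, t))))"
    by (rule sum.swap)
  also have "\<dots> = (\<Sum>a<n. \<Sum>b<n. \<Sum>t<m. A $$ (k, a) * cnj (A $$ (l, b)) * (Y $$ (a, t) * cnj (Y $$ (b, t))))"
    by (intro sum.cong refl sum.swap)
  also have "\<dots> = (\<Sum>a<n. \<Sum>b<n. A $$ (k, a) * cnj (A $$ (l, b)) * (Y * mat_adjoint Y) $$ (a, b))"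
    unfolding sum_distrib_left[symmetric]
    by (intro sum.cong refl) (simp add: index_gram[OF Y] del: index_mult_mat(1))
  finally show ?thesis .
qed

text \<open>
  The entries of the block diagonal part of \<open>P - K\<^sup>* P K\<close> for \<open>P = Y Y\<^sup>*\<close>, where \<open>\<beta>\<close> assigns blocks
  to indices. Writing \<open>K\<^sup>* P K\<close> as the Gram matrix of \<open>K\<^sup>* Y\<close> exhibits the vanishing of the defect
  as an equality of Gram matrices of rows of \<open>Y\<close> and of \<open>K\<^sup>* Y\<close>.
\<close>

definition block_defect :: "(nat \<Rightarrow> nat) \<Rightarrow> complex mat \<Rightarrow> complex mat \<Rightarrow> nat \<times> nat \<Rightarrow> complex" where
  "block_defect \<beta> K Y = (\<lambda>(k, l). if \<beta> k = \<beta> l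
    then (Y * mat_adjoint Y) $$ (k, l) - (mat_adjoint K * Y * mat_adjoint (mat_adjoint K * Y)) $$ (k, l) else 0)"

text \<open>
  The defect depends on \<open>Y\<close> only through \<open>Y Y\<^sup>*\<close>, and linearly.
\<close>

lemma block_defect_combination:
  fixes K X Y Z :: "complex mat"
  assumes K: "K \<in> carrier_mat n n" and Y: "Y \<in> carrier_mat n l" and Z: "Z \<in> carrier_mat n m"
    and X: "X \<in> carrier_mat n r"
    and comb: "X * mat_adjoint X = a \<cdot>\<^sub>m (Y * mat_adjoint Y) + b \<cdot>\<^sub>m (Z * mat_adjoint Z)"
    and p: "p \<in> {..<n} \<times> {..<n}"
  shows "block_defect \<beta> K X p = a * block_defect \<beta> K Y p + b * block_defect \<beta> K Z p"
proof -
  obtain i j where p': "p = (i, j)" "i < n" "j < n" using p by auto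
  have entry: "(X * mat_adjoint X) $$ (i, j) = a * (Y * mat_adjoint Y) $$ (i, j) + b * (Z * mat_adjoint Z) $$ (i, j)"
    if "i < n" "j < n" for i j
    unfolding comb using that Y Z by (simp del: index_mult_mat(1))
  have "(mat_adjoint K * X * mat_adjoint (mat_adjoint K * X)) $$ (i, j)
      = a * (mat_adjoint K * Y * mat_adjoint (mat_adjoint K * Y)) $$ (i, j)
        + b * (mat_adjoint K * Z * mat_adjoint (mat_adjoint K * Z)) $$ (i, j)"
    unfolding index_gram_mult[OF mat_adjoint_carrier[OF K] X p'(2,3)]
      index_gram_mult[OF mat_adjoint_carrier[OF K] Y p'(2,3)]
      index_gram_mult[OF mat_adjoint_carrier[OF K] Z p'(2,3)] sum_distrib_left sum.distrib[symmetric]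
    by (intro sum.cong refl) (simp only: entry lessThan_iff algebra_simps)
  then show ?thesis
    unfolding block_defect_def p'(1) by (simp add: entry[OF p'(2,3)] algebra_simps del: index_mult_mat(1))
qed

lemma frobenius_gram:
  fixes Y :: "complex mat"
  assumes "Y \<in> carrier_mat n m"
  shows "(\<Sum>(i, j)\<in>{..<n} \<times> {..<m}. of_real ((cmod (Y $$ (i, j)))\<^sup>2)) = (\<Sum>i<n. (Y * mat_adjoint Y) $$ (i, i))"
  unfolding sum.cartesian_product[symmetric] complex_norm_square
  using assms by (intro sum.cong refl) (simp add: index_gram del: index_mult_mat(1))

lemma continuous_on_block_defect:
  fixes K :: "complex mat"
  assumes K: "K \<in> carrier_mat n n" and p: "p \<in> {..<n} \<times> {..<n}"
  shows "continuous_on UNIV (\<lambda>y :: nat \<times> nat \<Rightarrow> complex. block_defect \<beta> K (mat n n y) p)"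
proof -
  obtain k l where p': "p = (k, l)" "k < n" "l < n" using p by auto
  have gram: "(mat n n y * mat_adjoint (mat n n y)) $$ (a, b) = (\<Sum>t<n. y (a, t) * cnj (y (b, t)))"
    if "a < n" "b < n" for y :: "nat \<times> nat \<Rightarrow> complex" and a b
    unfolding index_gram[OF mat_carrier that] using that by (intro sum.cong) auto
  have eq: "block_defect \<beta> K (mat n n y) p = (if \<beta> k = \<beta> l then (\<Sum>t<n. y (k, t) * cnj (y (l, t)))
      - (\<Sum>a<n. \<Sum>b<n. mat_adjoint K $$ (k, a) * cnj (mat_adjoint K $$ (l, b)) * (\<Sum>t<n. y (a, t) * cnj (y (b, t)))) else 0)"
    for y :: "nat \<times> nat \<Rightarrow> complex"
    unfolding block_defect_def p'(1) split gram[OF p'(2,3)]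
      index_gram_mult[OF mat_adjoint_carrier[OF K] mat_carrier p'(2,3)]
    by (intro if_cong refl arg_cong2[of _ _ _ _ minus] sum.cong) (simp add: gram del: index_mult_mat(1))
  show ?thesis
  proof (cases "\<beta> k = \<beta> l")
    case True
    then show ?thesis
      unfolding eq if_P[OF True] by (intro continuous_intros continuous_on_product_coordinates)
  next
    case False
    then show ?thesis unfolding eq if_not_P[OF False] by (intro continuous_intros)
  qed
qed

lemma quadratic_form_bound_of_unit:
  fixes H K :: "complex mat"
  assumes H: "H \<in> carrier_mat n n" and K: "K \<in> carrier_mat n n"
    and unit: "\<And>u. u \<in> carrier_vec n \<Longrightarrow> (\<Sum>k<n. (cmod (u $ k))\<^sup>2) = 1 \<Longrightarrow>
      c \<le> Re ((H *\<^sub>v u) \<bullet>c u) - Re ((H *\<^sub>v (K *\<^sub>v u)) \<bullet>c (K *\<^sub>v u))"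
    and v: "v \<in> carrier_vec n"
  shows "c * (\<Sum>k<n. (cmod (v $ k))\<^sup>2) \<le> Re ((H *\<^sub>v v) \<bullet>c v) - Re ((H *\<^sub>v (K *\<^sub>v v)) \<bullet>c (K *\<^sub>v v))"
proof (cases "v = 0\<^sub>v n")
  case True
  have "K *\<^sub>v 0\<^sub>v n = 0\<^sub>v n" using K by (intro eq_vecI) auto
  moreover have "H *\<^sub>v 0\<^sub>v n = 0\<^sub>v n" using H by (intro eq_vecI) auto
  ultimately show ?thesis using True by simp
next
  case False
  define s where "s = (\<Sum>k<n. (cmod (v $ k))\<^sup>2)"
  obtain k where "k < n" "v $ k \<noteq> 0"
    using False v by (metis carrier_vecD eq_vecI index_zero_vec(1) index_zero_vec(2))
  then have s: "s > 0" unfolding s_def by (intro sum_pos2[of _ k]) auto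
  define r where "r = complex_of_real (1 / sqrt s)"
  have r2: "(cmod r)\<^sup>2 = 1 / s" using s by (simp add: r_def power_divide norm_divide)
  have "(\<Sum>k<n. (cmod ((r \<cdot>\<^sub>v v) $ k))\<^sup>2) = (cmod r)\<^sup>2 * s"
    unfolding s_def sum_distrib_left using v by (intro sum.cong) (auto simp: norm_mult power_mult_distrib)
  then have one: "(\<Sum>k<n. (cmod ((r \<cdot>\<^sub>v v) $ k))\<^sup>2) = 1" using r2 s by simp
  have Kr: "K *\<^sub>v (r \<cdot>\<^sub>v v) = r \<cdot>\<^sub>v (K *\<^sub>v v)" using K v by (rule mult_mat_vec)
  have Kv: "K *\<^sub>v v \<in> carrier_vec n" using mult_mat_vec_carrier[OF K v] .
  have "c \<le> 1 / s * (Re ((H *\<^sub>v v) \<bullet>c v) - Re ((H *\<^sub>v (K *\<^sub>v v)) \<bullet>c (K *\<^sub>v v)))"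
    using unit[OF smult_carrier_vec[THEN iffD2, OF v] one]
    unfolding Kr quadratic_form_smult[OF H v] quadratic_form_smult[OF H Kv] r2
    by (simp add: algebra_simps)
  then show ?thesis using s unfolding s_def[symmetric] by (simp add: field_simps)
qed

text \<open>
  \<open>H\<close> is the defect of least norm among those of \<open>Y\<close> in the Frobenius unit sphere, and \<open>c\<close> its squared
  norm. Convexity of the set of matrices \<open>Y Y\<^sup>*\<close> allows a comparison of \<open>H\<close> with the segment towards
  the defect of \<open>u u\<^sup>*\<close>, for a unit vector \<open>u\<close>. The resulting inner product of \<open>H\<close> with that defect is
  \<open>u\<^sup>* H u - (K\<^sup>* u)\<^sup>* H (K\<^sup>* u)\<close>, because \<open>H\<close> vanishes outside the diagonal blocks.
\<close>

lemma block_separation: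
  fixes K :: "complex mat"
  assumes K: "K \<in> carrier_mat n n" and n: "n \<ge> 1"
    and nontrivial: "\<And>Y. Y \<in> carrier_mat n n \<Longrightarrow> Y \<noteq> 0\<^sub>m n n \<Longrightarrow> \<exists>p \<in> {..<n} \<times> {..<n}. block_defect \<beta> K Y p \<noteq> 0"
  obtains H c where "H \<in> carrier_mat n n" "mat_adjoint H = H"
    "\<And>k l. k < n \<Longrightarrow> l < n \<Longrightarrow> \<beta> k \<noteq> \<beta> l \<Longrightarrow> H $$ (k, l) = 0" "c > 0"
    "\<And>v. v \<in> carrier_vec n \<Longrightarrow> c * (\<Sum>k<n. (cmod (v $ k))\<^sup>2)
      \<le> Re ((H *\<^sub>v v) \<bullet>c v) - Re ((H *\<^sub>v (mat_adjoint K *\<^sub>v v)) \<bullet>c (mat_adjoint K *\<^sub>v v))"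
proof -
  define I :: "(nat \<times> nat) set" where "I = {..<n} \<times> {..<n}"
  define S where "S = {y :: nat \<times> nat \<Rightarrow> complex. (\<forall>p. p \<notin> I \<longrightarrow> y p = 0) \<and> (\<Sum>p\<in>I. (cmod (y p))\<^sup>2) = 1}"
  define f where "f y = (\<Sum>p\<in>I. (cmod (block_defect \<beta> K (mat n n y) p))\<^sup>2)" for y
  have finI: "finite I" unfolding I_def by auto
  have I0: "(0, 0) \<in> I" unfolding I_def using n by auto
  have "compact S" unfolding S_def using finI by (rule compact_unit_sphere)
  moreover have "(\<lambda>p. if p = (0, 0) then 1 else 0) \<in> S"
  proof -
    have "(\<Sum>p\<in>I. (cmod (if p = (0, 0) then 1 else 0))\<^sup>2) = (\<Sum>p\<in>I. if p = (0, 0) then 1 else (0::real))"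
      by (intro sum.cong) auto
    then show ?thesis using I0 finI by (auto simp: S_def)
  qed
  moreover have "continuous_on UNIV f"
    unfolding f_def I_def by (intro continuous_intros continuous_on_block_defect[OF K])
  then have "continuous_on S f" by (rule continuous_on_subset) simp
  ultimately obtain y0 where y0: "y0 \<in> S" and min: "\<And>y. y \<in> S \<Longrightarrow> f y0 \<le> f y"
    using continuous_attains_inf[of S f] by blast
  define Y where "Y = mat n n y0"
  have Y: "Y \<in> carrier_mat n n" unfolding Y_def by simp
  have frob: "(\<Sum>i<n. (M * mat_adjoint M) $$ (i, i)) = (\<Sum>p\<in>I. of_real ((cmod (M $$ p))\<^sup>2))"
    if "M \<in> carrier_mat n n" for M
    unfolding frobenius_gram[OF that, symmetric] I_def by (simp add: case_prod_unfold)
  have Yunit: "(\<Sum>i<n. (Y * mat_adjoint Y) $$ (i, i)) = 1"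
  proof -
    have "(\<Sum>p\<in>I. (cmod (Y $$ p))\<^sup>2) = (\<Sum>p\<in>I. (cmod (y0 p))\<^sup>2)"
      by (intro sum.cong) (auto simp: Y_def I_def)
    then have "(\<Sum>p\<in>I. (cmod (Y $$ p))\<^sup>2) = 1" using y0 by (simp add: S_def)
    then show ?thesis unfolding frob[OF Y] of_real_sum[symmetric] by simp
  qed
  have "Y \<noteq> 0\<^sub>m n n"
  proof
    assume Y0: "Y = 0\<^sub>m n n"
    have "(\<Sum>p\<in>I. complex_of_real ((cmod (Y $$ p))\<^sup>2)) = 0"
      by (intro sum.neutral) (auto simp: Y0 I_def)
    then show False using Yunit unfolding frob[OF Y] by simp
  qed
  then obtain p where p: "p \<in> I" "block_defect \<beta> K Y p \<noteq> 0"
    using nontrivial[OF Y] unfolding I_def by blast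
  define c where "c = f y0"
  have c: "c > 0"
    unfolding c_def f_def Y_def[symmetric] using p finI by (intro sum_pos2[of _ p]) auto
  define H where "H = mat n n (block_defect \<beta> K Y)"
  have H: "H \<in> carrier_mat n n" unfolding H_def by simp
  have Hadj: "mat_adjoint H = H"
  proof (rule eq_matI)
    fix k l assume "k < dim_row H" "l < dim_col H"
    then have kl: "k < n" "l < n" using H by auto
    have herm: "cnj ((M * mat_adjoint M) $$ (l, k)) = (M * mat_adjoint M) $$ (k, l)"
      if M: "M \<in> carrier_mat n n" for M
      unfolding index_gram[OF M kl] index_gram[OF M kl(2,1)] cnj_sum
      by (intro sum.cong) auto
    show "mat_adjoint H $$ (k, l) = H $$ (k, l)"
      using kl herm[OF Y] herm[OF mult_carrier_mat[OF mat_adjoint_carrier[OF K] Y]] H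
      by (auto simp: H_def block_defect_def simp del: index_mult_mat(1))
  qed (use H in auto)
  have block: "H $$ (k, l) = 0" if "k < n" "l < n" "\<beta> k \<noteq> \<beta> l" for k l
    using that by (simp add: H_def block_defect_def)
  have bound: "c \<le> Re ((H *\<^sub>v u) \<bullet>c u) - Re ((H *\<^sub>v (mat_adjoint K *\<^sub>v u)) \<bullet>c (mat_adjoint K *\<^sub>v u))"
    if u: "u \<in> carrier_vec n" and one: "(\<Sum>k<n. (cmod (u $ k))\<^sup>2) = 1" for u
  proof -
    \<comment> \<open>the vector \<open>u\<close> as a column, so that \<open>Z Z\<^sup>* = u u\<^sup>*\<close>\<close>
    define Z where "Z = mat n 1 (\<lambda>(i, j). u $ i)"
    define w where "w = mat_adjoint K *\<^sub>v u"
    have w: "w \<in> carrier_vec n" unfolding w_def using mult_mat_vec_carrier[OF mat_adjoint_carrier[OF K] u] .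
    have Z: "Z \<in> carrier_mat n 1" unfolding Z_def by simp
    have ZZ: "(Z * mat_adjoint Z) $$ (k, l) = u $ k * cnj (u $ l)" if "k < n" "l < n" for k l
      unfolding index_gram[OF Z that] using that by (simp add: Z_def)
    have KZ: "mat_adjoint K * Z \<in> carrier_mat n 1" using mult_carrier_mat[OF mat_adjoint_carrier[OF K] Z] .
    have KZZ: "(mat_adjoint K * Z * mat_adjoint (mat_adjoint K * Z)) $$ (k, l) = w $ k * cnj (w $ l)"
      if "k < n" "l < n" for k l
    proof -
      have z: "0 < (1 :: nat)" by simp
      have "(mat_adjoint K * Z) $$ (i, 0) = w $ i" if i: "i < n" for i
        unfolding w_def index_mult_mat_vec_sum[OF mat_adjoint_carrier[OF K] u i]
          index_mult_mat_sum[OF mat_adjoint_carrier[OF K] Z i z]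
        by (intro sum.cong) (auto simp: Z_def)
      then show ?thesis
        unfolding index_gram[OF KZ that] using that by (simp del: index_mult_mat(1))
    qed
    have "f y0 \<le> Re (\<Sum>p\<in>I. block_defect \<beta> K Y p * cnj (block_defect \<beta> K Z p))"
      unfolding f_def Y_def[symmetric]
    proof (rule first_order_optimality)
      fix t :: real assume t: "0 < t" "t \<le> 1"
      obtain X where X: "X \<in> carrier_mat n n"
        and XX: "X * mat_adjoint X = of_real (1 - t) \<cdot>\<^sub>m (Y * mat_adjoint Y) + of_real t \<cdot>\<^sub>m (Z * mat_adjoint Z)"
        using gram_convex[OF Y Z] t by (metis less_imp_le)
      define x where "x p = (if p \<in> I then X $$ p else 0)" for p
      have "mat n n x = X" using X by (intro eq_matI) (auto simp: x_def I_def)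
      have "(\<Sum>p\<in>I. complex_of_real ((cmod (x p))\<^sup>2)) = (\<Sum>i<n. (X * mat_adjoint X) $$ (i, i))"
        unfolding frob[OF X] by (intro sum.cong) (auto simp: x_def)
      also have "\<dots> = (\<Sum>i<n. of_real (1 - t) * (Y * mat_adjoint Y) $$ (i, i) + of_real t * (u $ i * cnj (u $ i)))"
        using Y Z by (intro sum.cong refl) (simp add: XX ZZ del: index_mult_mat(1))
      also have "\<dots> = of_real (1 - t) * (\<Sum>i<n. (Y * mat_adjoint Y) $$ (i, i)) + of_real t * of_real (\<Sum>i<n. (cmod (u $ i))\<^sup>2)"
        by (simp only: sum.distrib sum_distrib_left of_real_sum complex_norm_square)
      also have "\<dots> = 1" unfolding Yunit one by simp
      finally have "(\<Sum>p\<in>I. (cmod (x p))\<^sup>2) = 1"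
        unfolding of_real_sum[symmetric] of_real_eq_1_iff .
      then have "x \<in> S" by (simp add: S_def x_def)
      then have "f y0 \<le> f x" by (rule min)
      also have "f x = (\<Sum>p\<in>I. (cmod (of_real (1 - t) * block_defect \<beta> K Y p + of_real t * block_defect \<beta> K Z p))\<^sup>2)"
        unfolding f_def \<open>mat n n x = X\<close> I_def
        by (intro sum.cong refl) (simp only: block_defect_combination[OF K Y Z X XX])
      finally show "(\<Sum>p\<in>I. (cmod (block_defect \<beta> K Y p))\<^sup>2)
          \<le> (\<Sum>p\<in>I. (cmod (of_real (1 - t) * block_defect \<beta> K Y p + of_real t * block_defect \<beta> K Z p))\<^sup>2)"
        unfolding f_def Y_def .
    qed
    also have "(\<Sum>p\<in>I. block_defect \<beta> K Y p * cnj (block_defect \<beta> K Z p))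
        = (\<Sum>k<n. \<Sum>l<n. H $$ (k, l) * u $ l * cnj (u $ k) - H $$ (k, l) * w $ l * cnj (w $ k))"
      unfolding I_def sum.cartesian_product
      by (intro sum.cong refl) (auto simp: H_def block_defect_def ZZ KZZ algebra_simps simp del: index_mult_mat(1))
    also have "\<dots> = (H *\<^sub>v u) \<bullet>c u - (H *\<^sub>v w) \<bullet>c w"
      unfolding quadratic_form_sum[OF H u] quadratic_form_sum[OF H w] by (simp add: sum_subtractf)
    finally show ?thesis unfolding c_def w_def by simp
  qed
  show ?thesis
    by (rule that[OF H Hadj block c quadratic_form_bound_of_unit[OF H mat_adjoint_carrier[OF K] bound]])
qed

section \<open>Zeros at unitary matrices\<close>

lemma mult_add_less:
  fixes i s n m :: nat
  assumes "i < n" "s < m"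
  shows "i * m + s < n * m"
proof -
  have "i * m + s < Suc i * m" using assms by simp
  also have "\<dots> \<le> n * m" using assms by (intro mult_le_mono1) simp
  finally show ?thesis .
qed

lemma mult_add_eq_iff:
  fixes i k s t m :: nat
  assumes "s < m" "t < m"
  shows "i * m + s = k * m + t \<longleftrightarrow> i = k \<and> s = t"
proof
  assume eq: "i * m + s = k * m + t"
  have "(i * m + s) div m = i" "(k * m + t) div m = k" "(i * m + s) mod m = s" "(k * m + t) mod m = t"
    using assms by simp_all
  then show "i = k \<and> s = t" using eq by simp
qed simp

lemma sum_div_mod:
  fixes f :: "nat \<Rightarrow> nat \<Rightarrow> 'a :: comm_monoid_add"
  shows "(\<Sum>r<n * m. f (r div m) (r mod m)) = (\<Sum>i<n. \<Sum>s<m. f i s)"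
proof (cases "m = 0")
  case False
  have "(\<Sum>r<n * m. f (r div m) (r mod m)) = (\<Sum>(i, s)\<in>{..<n} \<times> {..<m}. f i s)"
    by (rule sum.reindex_bij_witness[of _ "\<lambda>(i, s). i * m + s" "\<lambda>r. (r div m, r mod m)"])
      (use False in \<open>auto simp: less_mult_imp_div_less mult_add_less\<close>)
  then show ?thesis by (simp add: sum.cartesian_product)
qed simp

lemma kronecker_carrier [simp, intro]:
  "A \<in> carrier_mat n1 n2 \<Longrightarrow> B \<in> carrier_mat m1 m2 \<Longrightarrow> A \<otimes>\<^sub>K B \<in> carrier_mat (n1 * m1) (n2 * m2)"
  by (auto simp: kronecker_def)

lemma index_kronecker:
  assumes "A \<in> carrier_mat n1 n2" "B \<in> carrier_mat m1 m2" "r < n1 * m1" "c < n2 * m2"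
  shows "(A \<otimes>\<^sub>K B) $$ (r, c) = A $$ (r div m1, c div m2) * B $$ (r mod m1, c mod m2)"
  using assms by (auto simp: kronecker_def)

lemma kronecker_one: "1\<^sub>m n \<otimes>\<^sub>K 1\<^sub>m m = 1\<^sub>m (n * m)"
proof (rule eq_matI)
  fix r c assume "r < dim_row (1\<^sub>m (n * m) :: complex mat)" "c < dim_col (1\<^sub>m (n * m) :: complex mat)"
  then have rc: "r < n * m" "c < n * m" by auto
  then have m: "m > 0" by (cases m) auto
  have "r = c \<longleftrightarrow> r div m = c div m \<and> r mod m = c mod m"
    by (metis div_mult_mod_eq)
  then show "(1\<^sub>m n \<otimes>\<^sub>K 1\<^sub>m m) $$ (r, c) = 1\<^sub>m (n * m) $$ (r, c)"
    using rc m by (simp add: index_kronecker[of _ n n _ m m] less_mult_imp_div_less)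
qed (auto simp: kronecker_def)

lemma block_offset_scale: "block_offset (\<lambda>j. ns j * m) d = block_offset ns d * m"
  by (simp add: block_offset_def sum_distrib_right)

text \<open>
  In the Kronecker product with an \<open>m \<times> m\<close> matrix, index \<open>i * m + s\<close> stands for the pair \<open>(i, s)\<close>.
  The block sizes get multiplied by \<open>m\<close>, and the block of the pair is the block of \<open>i\<close>.
\<close>

lemma block_scale:
  assumes "i < block_offset ns d" "s < m"
  shows "block_of (\<lambda>j. ns j * m) (i * m + s) = block_of ns i"
    "pos_in_block (\<lambda>j. ns j * m) (i * m + s) = pos_in_block ns i * m + s"
proof -
  obtain j a where ja: "j < d" "a < ns j" "i = block_offset ns j + a"
    using assms(1) by (rule block_index_cases)
  have eq: "i * m + s = block_offset (\<lambda>j. ns j * m) j + (a * m + s)"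
    unfolding ja block_offset_scale by (simp add: algebra_simps)
  have less: "a * m + s < ns j * m" using ja assms by (intro mult_add_less)
  show "block_of (\<lambda>j. ns j * m) (i * m + s) = block_of ns i"
    unfolding eq block_of_offset[of "a * m + s" "\<lambda>j. ns j * m", OF less] using ja by simp
  show "pos_in_block (\<lambda>j. ns j * m) (i * m + s) = pos_in_block ns i * m + s"
    unfolding eq pos_in_block_offset[of "a * m + s" "\<lambda>j. ns j * m", OF less] using ja by simp
qed

lemma index_direct_sum_kronecker:
  assumes U: "\<And>j. j < d \<Longrightarrow> U j \<in> carrier_mat m m"
    and i: "i < block_offset ns d" "s < m" and k: "k < block_offset ns d" "t < m"
  shows "direct_sum_mat d (\<lambda>j. 1\<^sub>m (ns j) \<otimes>\<^sub>K U j) $$ (i * m + s, k * m + t)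
    = (if i = k then U (block_of ns i) $$ (s, t) else 0)"
proof -
  let ?ns = "\<lambda>j. ns j * m"
  have carr: "1\<^sub>m (ns j) \<otimes>\<^sub>K U j \<in> carrier_mat (?ns j) (?ns j)" if "j < d" for j
    using U[OF that] by auto
  have bounds: "i * m + s < block_offset ?ns d" "k * m + t < block_offset ?ns d"
    unfolding block_offset_scale using i k by (auto intro: mult_add_less)
  have "(1\<^sub>m (ns (block_of ns i)) \<otimes>\<^sub>K U (block_of ns i)) $$ (pos_in_block ns i * m + s, pos_in_block ns k * m + t)
      = (if i = k then U (block_of ns i) $$ (s, t) else 0)" if eq: "block_of ns i = block_of ns k"
  proof -
    have ip: "pos_in_block ns i < ns (block_of ns i)" "pos_in_block ns k < ns (block_of ns i)"
      using pos_in_block_less[OF i(1)] pos_in_block_less[OF k(1)] eq by auto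
    have ik: "i = k \<longleftrightarrow> pos_in_block ns i = pos_in_block ns k"
      using offset_pos_in_block[OF i(1)] offset_pos_in_block[OF k(1)] eq by metis
    have m: "m > 0" using i(2) by simp
    show ?thesis
      unfolding index_kronecker[OF one_carrier_mat U[OF block_of_less[OF i(1)]]
        mult_add_less[OF ip(1) i(2)] mult_add_less[OF ip(2) k(2)]]
      using i k ip ik m by simp
  qed
  moreover have "direct_sum_mat d (\<lambda>j. 1\<^sub>m (ns j) \<otimes>\<^sub>K U j) $$ (i * m + s, k * m + t)
      = (if block_of ?ns (i * m + s) = block_of ?ns (k * m + t)
        then (1\<^sub>m (ns (block_of ?ns (i * m + s))) \<otimes>\<^sub>K U (block_of ?ns (i * m + s)))
          $$ (pos_in_block ?ns (i * m + s), pos_in_block ?ns (k * m + t)) else 0)"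
    by (rule index_direct_sum_mat[of d "\<lambda>j. 1\<^sub>m (ns j) \<otimes>\<^sub>K U j" ?ns]) (use carr bounds in auto)
  ultimately show ?thesis
    unfolding block_scale[OF i] block_scale[OF k] by (cases "block_of ns i = block_of ns k") auto
qed

text \<open>
  A left kernel vector \<open>v\<close> of \<open>I - (K \<otimes> I) (\<oplus>\<^sub>j I \<otimes> U\<^sub>j)\<close> is folded into the matrix \<open>Y\<close> with entries
  \<open>cnj (v (k * m + t))\<close>. The entry of \<open>(K \<otimes> I) (\<oplus>\<^sub>j I \<otimes> U\<^sub>j)\<close> at the pairs \<open>(i, s)\<close>, \<open>(k, t)\<close> is the product of
  \<open>K\<close> at \<open>(i, k)\<close> and \<open>U\<^sub>j\<close> at \<open>(s, t)\<close>, with \<open>j\<close> the block of \<open>k\<close>; conjugation turns the transposes that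
  arise into adjoints.
\<close>

lemma eval_at_mats_zero_iff:
  assumes n: "n = block_offset ns d" and K: "K \<in> carrier_mat n n"
    and p: "poly_eval p (\<lambda>_. 0) \<noteq> 0"
    and U: "\<And>j. j < d \<Longrightarrow> U j \<in> carrier_mat m m"
  shows "eval_at_mats d ns K p m U = 0 \<longleftrightarrow> (\<exists>Y \<in> carrier_mat n m. Y \<noteq> 0\<^sub>m n m \<and>
    (\<forall>k<n. row Y k = mat_adjoint (U (block_of ns k)) *\<^sub>v row (mat_adjoint K * Y) k))"
proof -
  let ?\<beta> = "block_of ns"
  define D where "D = direct_sum_mat d (\<lambda>j. 1\<^sub>m (ns j) \<otimes>\<^sub>K U j)"
  define M where "M = 1\<^sub>m (n * m) - (K \<otimes>\<^sub>K 1\<^sub>m m) * D"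
  have "direct_sum_mat d (\<lambda>j. 1\<^sub>m (ns j) \<otimes>\<^sub>K U j)
      \<in> carrier_mat (block_offset (\<lambda>j. ns j * m) d) (block_offset (\<lambda>j. ns j * m) d)"
    using U by (intro direct_sum_mat_carrier) auto
  then have D: "D \<in> carrier_mat (n * m) (n * m)"
    unfolding D_def n block_offset_scale .
  have KI: "K \<otimes>\<^sub>K 1\<^sub>m m \<in> carrier_mat (n * m) (n * m)" using K by auto
  have M: "M \<in> carrier_mat (n * m) (n * m)" unfolding M_def using D KI by auto
  have M_entry: "M $$ (i * m + s, k * m + t)
      = (if i = k \<and> s = t then 1 else 0) - K $$ (i, k) * U (?\<beta> k) $$ (s, t)"
    if st: "i < n" "s < m" and kt: "k < n" "t < m" for i s k t
  proof -
    have m: "m > 0" using st by simp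
    note r = mult_add_less[OF st] and c = mult_add_less[OF kt]
    have "((K \<otimes>\<^sub>K 1\<^sub>m m) * D) $$ (i * m + s, k * m + t)
        = (\<Sum>q<n * m. K $$ (i, q div m) * (if s = q mod m then 1 else 0)
            * (if q div m = k then U (?\<beta> (q div m)) $$ (q mod m, t) else 0))"
      unfolding index_mult_mat_sum[OF KI D r c]
    proof (intro sum.cong refl)
      fix q assume "q \<in> {..<n * m}"
      then have q: "q < n * m" by simp
      have q': "q div m < n" "q mod m < m" "q div m * m + q mod m = q"
        using q m by (auto simp: less_mult_imp_div_less)
      have "D $$ (q, k * m + t) = (if q div m = k then U (?\<beta> (q div m)) $$ (q mod m, t) else 0)"
        using index_direct_sum_kronecker[of d U m "q div m" ns "q mod m" k t] U q' kt
        unfolding D_def n by simp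
      then show "(K \<otimes>\<^sub>K 1\<^sub>m m) $$ (i * m + s, q) * D $$ (q, k * m + t)
          = K $$ (i, q div m) * (if s = q mod m then 1 else 0)
            * (if q div m = k then U (?\<beta> (q div m)) $$ (q mod m, t) else 0)"
        using index_kronecker[OF K one_carrier_mat r q] st q' m by simp
    qed
    also have "\<dots> = (\<Sum>a<n. \<Sum>b<m. K $$ (i, a) * (if s = b then 1 else 0) * (if a = k then U (?\<beta> a) $$ (b, t) else 0))"
      by (rule sum_div_mod[of "\<lambda>a b. K $$ (i, a) * (if s = b then 1 else 0) * (if a = k then U (?\<beta> a) $$ (b, t) else 0)"])
    also have "\<dots> = (\<Sum>a<n. \<Sum>b<m. if s = b then (if a = k then K $$ (i, a) * U (?\<beta> a) $$ (b, t) else 0) else 0)"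
      by (intro sum.cong) auto
    also have "\<dots> = K $$ (i, k) * U (?\<beta> k) $$ (s, t)"
      using st kt by simp
    finally have KD: "((K \<otimes>\<^sub>K 1\<^sub>m m) * D) $$ (i * m + s, k * m + t) = K $$ (i, k) * U (?\<beta> k) $$ (s, t)" .
    have "i * m + s = k * m + t \<longleftrightarrow> i = k \<and> s = t"
      using mult_add_eq_iff[OF st(2) kt(2)] .
    then show ?thesis
      unfolding M_def using r c KD KI D by (simp del: index_mult_mat(1))
  qed
  have "eval_at_mats d ns K p m U = 0 \<longleftrightarrow> det M = 0"
    unfolding eval_at_mats_def M_def D_def Let_def kronecker_one n using p by (simp add: block_offset_def kronecker_one)
  also have "\<dots> \<longleftrightarrow> det (transpose_mat M) = 0"
    using det_transpose[OF M] by simp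
  also have "\<dots> \<longleftrightarrow> (\<exists>v. v \<in> carrier_vec (n * m) \<and> v \<noteq> 0\<^sub>v (n * m) \<and> transpose_mat M *\<^sub>v v = 0\<^sub>v (n * m))"
    using M by (intro det_0_iff_vec_prod_zero) auto
  finally have eval_iff: "eval_at_mats d ns K p m U = 0
    \<longleftrightarrow> (\<exists>v. v \<in> carrier_vec (n * m) \<and> v \<noteq> 0\<^sub>v (n * m) \<and> transpose_mat M *\<^sub>v v = 0\<^sub>v (n * m))" .
  have MT: "transpose_mat M \<in> carrier_mat (n * m) (n * m)" using M by auto
  have kernel: "(transpose_mat M *\<^sub>v v) $ (k * m + t)
      = v $ (k * m + t) - (\<Sum>i<n. \<Sum>s<m. K $$ (i, k) * U (?\<beta> k) $$ (s, t) * v $ (i * m + s))"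
    if v: "v \<in> carrier_vec (n * m)" and kt: "k < n" "t < m" for v k t
  proof -
    have m: "m > 0" using kt by simp
    have "(transpose_mat M *\<^sub>v v) $ (k * m + t)
        = (\<Sum>r<n * m. M $$ (r div m * m + r mod m, k * m + t) * v $ (r div m * m + r mod m))"
      unfolding index_mult_mat_vec_sum[OF MT v mult_add_less[OF kt]]
      using M mult_add_less[OF kt] by (intro sum.cong) auto
    also have "\<dots> = (\<Sum>i<n. \<Sum>s<m. M $$ (i * m + s, k * m + t) * v $ (i * m + s))"
      by (rule sum_div_mod[of "\<lambda>i s. M $$ (i * m + s, k * m + t) * v $ (i * m + s)"])
    also have "\<dots> = (\<Sum>i<n. \<Sum>s<m. (if s = t then (if i = k then v $ (i * m + s) else 0) else 0)
        - K $$ (i, k) * U (?\<beta> k) $$ (s, t) * v $ (i * m + s))"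
      using kt by (intro sum.cong refl) (auto simp: M_entry left_diff_distrib)
    finally show ?thesis using kt by (simp add: sum_subtractf)
  qed
  have row_entry: "(mat_adjoint (U (?\<beta> k)) *\<^sub>v row (mat_adjoint K * Y) k) $ t
      = (\<Sum>i<n. \<Sum>s<m. cnj (K $$ (i, k)) * cnj (U (?\<beta> k) $$ (s, t)) * Y $$ (i, s))"
    if Y: "Y \<in> carrier_mat n m" and kt: "k < n" "t < m" for Y k t
  proof -
    have Uk: "U (?\<beta> k) \<in> carrier_mat m m" using kt(1) unfolding n by (intro U block_of_less)
    have KY: "mat_adjoint K * Y \<in> carrier_mat n m" using mult_carrier_mat[OF mat_adjoint_carrier[OF K] Y] .
    have row: "row (mat_adjoint K * Y) k \<in> carrier_vec m" using KY kt by auto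
    have "(mat_adjoint (U (?\<beta> k)) *\<^sub>v row (mat_adjoint K * Y) k) $ t
        = (\<Sum>s<m. cnj (U (?\<beta> k) $$ (s, t)) * (\<Sum>i<n. cnj (K $$ (i, k)) * Y $$ (i, s)))"
      unfolding index_mult_mat_vec_sum[OF mat_adjoint_carrier[OF Uk] row kt(2)]
      using Uk KY kt K Y
      by (intro sum.cong refl) (simp add: index_mult_mat_sum[OF mat_adjoint_carrier[OF K] Y] del: index_mult_mat(1))
    also have "\<dots> = (\<Sum>s<m. \<Sum>i<n. cnj (K $$ (i, k)) * cnj (U (?\<beta> k) $$ (s, t)) * Y $$ (i, s))"
      unfolding sum_distrib_left by (intro sum.cong) (auto simp: algebra_simps)
    also have "\<dots> = (\<Sum>i<n. \<Sum>s<m. cnj (K $$ (i, k)) * cnj (U (?\<beta> k) $$ (s, t)) * Y $$ (i, s))"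
      by (rule sum.swap)
    finally show ?thesis .
  qed
  have corr: "(\<forall>k<n. row Y k = mat_adjoint (U (?\<beta> k)) *\<^sub>v row (mat_adjoint K * Y) k)
      \<longleftrightarrow> transpose_mat M *\<^sub>v v = 0\<^sub>v (n * m)"
    if Y: "Y \<in> carrier_mat n m" and v: "v \<in> carrier_vec (n * m)"
      and Yv: "\<And>k t. k < n \<Longrightarrow> t < m \<Longrightarrow> Y $$ (k, t) = cnj (v $ (k * m + t))" for Y v
  proof -
    have pt: "row Y k $ t = (mat_adjoint (U (?\<beta> k)) *\<^sub>v row (mat_adjoint K * Y) k) $ t
        \<longleftrightarrow> (transpose_mat M *\<^sub>v v) $ (k * m + t) = 0" if kt: "k < n" "t < m" for k t
    proof -
      have "cnj ((transpose_mat M *\<^sub>v v) $ (k * m + t))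
          = row Y k $ t - (mat_adjoint (U (?\<beta> k)) *\<^sub>v row (mat_adjoint K * Y) k) $ t"
        unfolding kernel[OF v kt] row_entry[OF Y kt] using Y kt by (simp add: Yv)
      then show ?thesis by (metis complex_cnj_zero_iff eq_iff_diff_eq_0)
    qed
    have dims: "dim_vec (row Y k) = m" "dim_vec (mat_adjoint (U (?\<beta> k)) *\<^sub>v row (mat_adjoint K * Y) k) = m"
      if "k < n" for k
      using Y U[of "?\<beta> k"] block_of_less[of k ns d] that unfolding n by auto
    have "(\<forall>k<n. row Y k = mat_adjoint (U (?\<beta> k)) *\<^sub>v row (mat_adjoint K * Y) k)
        \<longleftrightarrow> (\<forall>k<n. \<forall>t<m. (transpose_mat M *\<^sub>v v) $ (k * m + t) = 0)"
      using pt dims by (auto simp: vec_eq_iff)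
    also have "\<dots> \<longleftrightarrow> (\<forall>r<n * m. (transpose_mat M *\<^sub>v v) $ r = 0)"
    proof (intro iffI allI impI)
      fix r assume all: "\<forall>k<n. \<forall>t<m. (transpose_mat M *\<^sub>v v) $ (k * m + t) = 0" and r: "r < n * m"
      then have "m > 0" by (cases m) auto
      then show "(transpose_mat M *\<^sub>v v) $ r = 0"
        using all[rule_format, of "r div m" "r mod m"] r by (simp add: less_mult_imp_div_less)
    qed (use mult_add_less in blast)
    also have "\<dots> \<longleftrightarrow> transpose_mat M *\<^sub>v v = 0\<^sub>v (n * m)"
      using MT by (auto simp: vec_eq_iff)
    finally show ?thesis .
  qed
  show ?thesis
    unfolding eval_iff
  proof
    assume "\<exists>v. v \<in> carrier_vec (n * m) \<and> v \<noteq> 0\<^sub>v (n * m) \<and> transpose_mat M *\<^sub>v v = 0\<^sub>v (n * m)"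
    then obtain v where v: "v \<in> carrier_vec (n * m)" "v \<noteq> 0\<^sub>v (n * m)" "transpose_mat M *\<^sub>v v = 0\<^sub>v (n * m)"
      by blast
    define Y where "Y = mat n m (\<lambda>(k, t). cnj (v $ (k * m + t)))"
    have Y: "Y \<in> carrier_mat n m" unfolding Y_def by simp
    obtain r where r: "r < n * m" "v $ r \<noteq> 0"
      using v(1,2) by (auto simp: vec_eq_iff)
    then have "m > 0" by (cases m) auto
    then have "Y $$ (r div m, r mod m) \<noteq> 0" "r div m < n" "r mod m < m"
      using r by (auto simp: Y_def less_mult_imp_div_less)
    then have "Y \<noteq> 0\<^sub>m n m" by auto
    then show "\<exists>Y \<in> carrier_mat n m. Y \<noteq> 0\<^sub>m n m \<and>
        (\<forall>k<n. row Y k = mat_adjoint (U (?\<beta> k)) *\<^sub>v row (mat_adjoint K * Y) k)"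
      using corr[OF Y v(1)] v(3) Y by (auto simp: Y_def intro!: bexI[of _ Y])
  next
    assume "\<exists>Y \<in> carrier_mat n m. Y \<noteq> 0\<^sub>m n m \<and>
        (\<forall>k<n. row Y k = mat_adjoint (U (?\<beta> k)) *\<^sub>v row (mat_adjoint K * Y) k)"
    then obtain Y where Y: "Y \<in> carrier_mat n m" "Y \<noteq> 0\<^sub>m n m"
      "\<forall>k<n. row Y k = mat_adjoint (U (?\<beta> k)) *\<^sub>v row (mat_adjoint K * Y) k"
      by blast
    define v where "v = vec (n * m) (\<lambda>r. cnj (Y $$ (r div m, r mod m)))"
    have v: "v \<in> carrier_vec (n * m)" unfolding v_def by simp
    have Yv: "Y $$ (k, t) = cnj (v $ (k * m + t))" if "k < n" "t < m" for k t
      unfolding v_def using that mult_add_less[OF that] by simp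
    obtain k t where kt: "k < n" "t < m" "Y $$ (k, t) \<noteq> 0"
      using Y(1,2) by (metis carrier_matD eq_matI index_zero_mat(1) index_zero_mat(2) index_zero_mat(3))
    then have "v $ (k * m + t) \<noteq> 0" using Yv by auto
    then have "v \<noteq> 0\<^sub>v (n * m)" using mult_add_less[OF kt(1,2)] by auto
    then show "\<exists>v. v \<in> carrier_vec (n * m) \<and> v \<noteq> 0\<^sub>v (n * m) \<and> transpose_mat M *\<^sub>v v = 0\<^sub>v (n * m)"
      using corr[OF Y(1) v Yv] Y(3) v by blast
  qed
qed

lemma unitary_mat_iff:
  assumes "U \<in> carrier_mat m m"
  shows "unitary_mat U \<longleftrightarrow> U * mat_adjoint U = 1\<^sub>m m \<and> mat_adjoint U * U = 1\<^sub>m m"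
  using assms unfolding unitary_mat_def inverts_mat_def by auto

text \<open>
  The kernel equation says that, within each block, one unitary matrix maps the rows of \<open>K\<^sup>* Y\<close> to
  those of \<open>Y\<close>. Such a unitary matrix exists exactly when the two families of rows have the same Gram
  matrix, which is the vanishing of the defect.
\<close>

lemma zero_at_unitaries_iff:
  assumes n: "n = block_offset ns d" and K: "K \<in> carrier_mat n n"
    and p: "poly_eval p (\<lambda>_. 0) \<noteq> 0"
  shows "(\<exists>U. (\<forall>j<d. U j \<in> carrier_mat m m \<and> unitary_mat (U j)) \<and> eval_at_mats d ns K p m U = 0)
    \<longleftrightarrow> (\<exists>Y \<in> carrier_mat n m. Y \<noteq> 0\<^sub>m n m \<and> (\<forall>q \<in> {..<n} \<times> {..<n}. block_defect (block_of ns) K Y q = 0))"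
    (is "?L \<longleftrightarrow> ?R")
proof
  let ?\<beta> = "block_of ns"
  have row_gram: "row M k \<bullet>c row M l = (M * mat_adjoint M) $$ (k, l)"
    if M: "M \<in> carrier_mat n m" and kl: "k < n" "l < n" for M :: "complex mat" and k l
  proof -
    have "row M l \<in> carrier_vec m" using M kl by auto
    then show ?thesis
      unfolding index_gram[OF M kl] cscalar_prod_sum[OF \<open>row M l \<in> carrier_vec m\<close>]
      using M kl by (intro sum.cong) auto
  qed
  have KY: "mat_adjoint K * Y \<in> carrier_mat n m" if "Y \<in> carrier_mat n m" for Y :: "complex mat"
    using mult_carrier_mat[OF mat_adjoint_carrier[OF K] that] .
  {
    assume ?L
    then obtain U where U: "\<And>j. j < d \<Longrightarrow> U j \<in> carrier_mat m m" "\<And>j. j < d \<Longrightarrow> unitary_mat (U j)"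
      and zero: "eval_at_mats d ns K p m U = 0"
      by blast
    have "\<exists>Y \<in> carrier_mat n m. Y \<noteq> 0\<^sub>m n m \<and>
        (\<forall>k<n. row Y k = mat_adjoint (U (?\<beta> k)) *\<^sub>v row (mat_adjoint K * Y) k)"
      by (rule iffD1[OF eval_at_mats_zero_iff[OF n K p] zero]) (rule U(1))
    then obtain Y where Y: "Y \<in> carrier_mat n m" "Y \<noteq> 0\<^sub>m n m"
      and rows: "\<And>k. k < n \<Longrightarrow> row Y k = mat_adjoint (U (?\<beta> k)) *\<^sub>v row (mat_adjoint K * Y) k"
      by blast
    have "block_defect ?\<beta> K Y (k, l) = 0" if kl: "k < n" "l < n" for k l
    proof (cases "?\<beta> k = ?\<beta> l")
      case True
      have j: "?\<beta> l < d" using kl(2) unfolding n by (rule block_of_less)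
      have Ua: "mat_adjoint (mat_adjoint (U (?\<beta> l))) * mat_adjoint (U (?\<beta> l)) = 1\<^sub>m m"
        using U(2)[OF j] unfolding unitary_mat_iff[OF U(1)[OF j]] mat_adjoint_adjoint by blast
      have "row (mat_adjoint K * Y) k \<in> carrier_vec m" "row (mat_adjoint K * Y) l \<in> carrier_vec m"
        using KY[OF Y(1)] kl by auto
      then have "row Y k \<bullet>c row Y l = row (mat_adjoint K * Y) k \<bullet>c row (mat_adjoint K * Y) l"
        unfolding rows[OF kl(1)] rows[OF kl(2)] True
        by (rule cscalar_prod_isometry[OF mat_adjoint_carrier[OF U(1)[OF j]] Ua])
      then show ?thesis
        using row_gram[OF Y(1) kl] row_gram[OF KY[OF Y(1)] kl] by (simp add: block_defect_def)
    qed (simp add: block_defect_def)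
    then show ?R using Y by blast
  next
    assume ?R
    then obtain Y where Y: "Y \<in> carrier_mat n m" "Y \<noteq> 0\<^sub>m n m"
      and defect: "\<And>k l. k < n \<Longrightarrow> l < n \<Longrightarrow> block_defect ?\<beta> K Y (k, l) = 0"
      by blast
    have ex: "\<exists>W \<in> carrier_mat m m. mat_adjoint W * W = 1\<^sub>m m \<and>
        (\<forall>k\<in>{k. k < n \<and> ?\<beta> k = j}. W *\<^sub>v row (mat_adjoint K * Y) k = row Y k)" for j
    proof (rule isometry_of_equal_gram)
      fix k l assume kl: "k \<in> {k. k < n \<and> ?\<beta> k = j}" "l \<in> {k. k < n \<and> ?\<beta> k = j}"
      then have kl': "k < n" "l < n" "?\<beta> k = ?\<beta> l" by auto
      show "row (mat_adjoint K * Y) k \<bullet>c row (mat_adjoint K * Y) l = row Y k \<bullet>c row Y l"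
        using defect[OF kl'(1,2)] kl'(3)
        unfolding row_gram[OF Y(1) kl'(1,2)] row_gram[OF KY[OF Y(1)] kl'(1,2)] by (simp add: block_defect_def)
    qed (use Y(1) KY[OF Y(1)] in auto)
    obtain W where "\<forall>j. W j \<in> carrier_mat m m \<and> mat_adjoint (W j) * W j = 1\<^sub>m m \<and>
        (\<forall>k\<in>{k. k < n \<and> ?\<beta> k = j}. W j *\<^sub>v row (mat_adjoint K * Y) k = row Y k)"
      using choice[OF allI[OF ex[unfolded Bex_def]]] by (rule exE)
    then have W: "W j \<in> carrier_mat m m" "mat_adjoint (W j) * W j = 1\<^sub>m m"
      "k < n \<Longrightarrow> W (?\<beta> k) *\<^sub>v row (mat_adjoint K * Y) k = row Y k" for j k
      by blast+
    define U where "U j = mat_adjoint (W j)" for j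
    have U: "U j \<in> carrier_mat m m" "unitary_mat (U j)" for j
      unfolding U_def unitary_mat_iff[OF mat_adjoint_carrier[OF W(1)]] mat_adjoint_adjoint
      using W(1,2)[of j] isometry_right_inverse[OF W(1,2)[of j]] by blast+
    have "eval_at_mats d ns K p m U = 0"
      unfolding eval_at_mats_zero_iff[OF n K p U(1)] U_def mat_adjoint_adjoint
      using Y W(3)[symmetric] by blast
    then show ?L using U by blast
  }
qed

text \<open>
  Summing the form of \<open>G\<close> over the columns of a matrix \<open>M\<close> gives the trace of \<open>G M M\<^sup>*\<close>. For \<open>M = Y\<close>
  and \<open>M = K\<^sup>* Y\<close> these traces agree if the defect vanishes, since \<open>G\<close> only sees diagonal blocks. But the
  hypothesis makes the first sum strictly larger.
\<close>

lemma defect_of_stein_positive: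
  fixes G K Y :: "complex mat"
  assumes G: "G \<in> carrier_mat n n" and K: "K \<in> carrier_mat n n"
    and block: "\<And>k l. k < n \<Longrightarrow> l < n \<Longrightarrow> \<beta> k \<noteq> \<beta> l \<Longrightarrow> G $$ (k, l) = 0"
    and pos: "\<And>v. v \<in> carrier_vec n \<Longrightarrow> v \<noteq> 0\<^sub>v n \<Longrightarrow>
      Re ((G *\<^sub>v (mat_adjoint K *\<^sub>v v)) \<bullet>c (mat_adjoint K *\<^sub>v v)) < Re ((G *\<^sub>v v) \<bullet>c v)"
    and Y: "Y \<in> carrier_mat n m" "Y \<noteq> 0\<^sub>m n m"
  shows "\<exists>q \<in> {..<n} \<times> {..<n}. block_defect \<beta> K Y q \<noteq> 0"
proof (rule ccontr)
  assume "\<not> ?thesis"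
  then have defect: "\<And>k l. k < n \<Longrightarrow> l < n \<Longrightarrow> block_defect \<beta> K Y (k, l) = 0" by blast
  define Z where "Z = mat_adjoint K * Y"
  have Z: "Z \<in> carrier_mat n m" unfolding Z_def using mult_carrier_mat[OF mat_adjoint_carrier[OF K] Y(1)] .
  have trace: "(\<Sum>t<m. (G *\<^sub>v col M t) \<bullet>c col M t) = (\<Sum>k<n. \<Sum>l<n. G $$ (k, l) * (M * mat_adjoint M) $$ (l, k))"
    if M: "M \<in> carrier_mat n m" for M
  proof -
    have "(\<Sum>t<m. (G *\<^sub>v col M t) \<bullet>c col M t)
        = (\<Sum>t<m. \<Sum>k<n. \<Sum>l<n. G $$ (k, l) * (M $$ (l, t) * cnj (M $$ (k, t))))"
    proof (intro sum.cong refl)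
      fix t assume "t \<in> {..<m}"
      then have t: "t < m" by simp
      have c: "col M t \<in> carrier_vec n" using M t by auto
      show "(G *\<^sub>v col M t) \<bullet>c col M t = (\<Sum>k<n. \<Sum>l<n. G $$ (k, l) * (M $$ (l, t) * cnj (M $$ (k, t))))"
        unfolding quadratic_form_sum[OF G c] using M t by (intro sum.cong refl) auto
    qed
    also have "\<dots> = (\<Sum>k<n. \<Sum>t<m. \<Sum>l<n. G $$ (k, l) * (M $$ (l, t) * cnj (M $$ (k, t))))"
      by (rule sum.swap)
    also have "\<dots> = (\<Sum>k<n. \<Sum>l<n. \<Sum>t<m. G $$ (k, l) * (M $$ (l, t) * cnj (M $$ (k, t))))"
      by (intro sum.cong refl sum.swap)
    also have "\<dots> = (\<Sum>k<n. \<Sum>l<n. G $$ (k, l) * (M * mat_adjoint M) $$ (l, k))"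
      unfolding sum_distrib_left[symmetric] by (intro sum.cong refl) (simp add: index_gram[OF M] del: index_mult_mat(1))
    finally show ?thesis .
  qed
  have "(\<Sum>k<n. \<Sum>l<n. G $$ (k, l) * (Y * mat_adjoint Y) $$ (l, k))
      = (\<Sum>k<n. \<Sum>l<n. G $$ (k, l) * (Z * mat_adjoint Z) $$ (l, k))"
  proof (intro sum.cong refl)
    fix k l assume "k \<in> {..<n}" "l \<in> {..<n}"
    then show "G $$ (k, l) * (Y * mat_adjoint Y) $$ (l, k) = G $$ (k, l) * (Z * mat_adjoint Z) $$ (l, k)"
      using defect[of l k] block[of k l] unfolding block_defect_def Z_def
      by (cases "\<beta> k = \<beta> l") (auto simp del: index_mult_mat(1))
  qed
  then have eq: "(\<Sum>t<m. Re ((G *\<^sub>v col Y t) \<bullet>c col Y t)) = (\<Sum>t<m. Re ((G *\<^sub>v col Z t) \<bullet>c col Z t))"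
    unfolding trace[OF Y(1), symmetric] trace[OF Z, symmetric] Re_sum[symmetric] by simp
  have colZ: "col Z t = mat_adjoint K *\<^sub>v col Y t" if "t < m" for t
    unfolding Z_def using Y(1) that by (intro col_mult2[OF mat_adjoint_carrier[OF K] Y(1)])
  have strict: "Re ((G *\<^sub>v col Z t) \<bullet>c col Z t) < Re ((G *\<^sub>v col Y t) \<bullet>c col Y t)"
    if t: "t < m" and "col Y t \<noteq> 0\<^sub>v n" for t
    unfolding colZ[OF t] using Y(1) that by (intro pos) auto
  have weak: "Re ((G *\<^sub>v col Z t) \<bullet>c col Z t) \<le> Re ((G *\<^sub>v col Y t) \<bullet>c col Y t)" if t: "t < m" for t
  proof (cases "col Y t = 0\<^sub>v n")
    case True
    have "mat_adjoint K *\<^sub>v 0\<^sub>v n = 0\<^sub>v n" using K by (intro eq_vecI) auto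
    then show ?thesis unfolding colZ[OF t] True by simp
  qed (use strict[OF t] in simp)
  obtain k t where kt: "k < n" "t < m" "Y $$ (k, t) \<noteq> 0"
    using Y by (metis carrier_matD eq_matI index_zero_mat(1) index_zero_mat(2) index_zero_mat(3))
  have "col Y t $ k \<noteq> 0" using kt Y(1) by auto
  then have "col Y t \<noteq> 0\<^sub>v n" using kt by auto
  then have "(\<Sum>t<m. Re ((G *\<^sub>v col Z t) \<bullet>c col Z t)) < (\<Sum>t<m. Re ((G *\<^sub>v col Y t) \<bullet>c col Y t))"
    using kt(2) weak strict[OF kt(2)] by (intro sum_strict_mono_ex1) auto
  then show False using eq by simp
qed

section \<open>Invertible block diagonal solutions\<close>

text \<open>
  The shift is singular only at the negative of an eigenvalue, and there are finitely many of these.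
\<close>

lemma invertible_shift_exists:
  fixes H :: "complex mat"
  assumes H: "H \<in> carrier_mat n n" and "0 < \<delta>"
  obtains e where "0 < e" "e < \<delta>" "det (H + of_real e \<cdot>\<^sub>m 1\<^sub>m n) \<noteq> 0"
proof -
  let ?R = "{z. poly (char_poly H) z = 0}"
  have "char_poly H \<noteq> 0" using degree_monic_char_poly[OF H] by auto
  then have "finite ((\<lambda>z. - Re z) ` ?R)" by (intro finite_imageI poly_roots_finite)
  moreover have "infinite {0<..<\<delta>}" using assms by (simp add: infinite_Ioo)
  ultimately have "infinite ({0<..<\<delta>} - (\<lambda>z. - Re z) ` ?R)" by (rule Diff_infinite_finite)
  then obtain e where e: "e \<in> {0<..<\<delta>} - (\<lambda>z. - Re z) ` ?R"
    using infinite_imp_nonempty by blast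
  have "- complex_of_real e \<notin> ?R"
  proof
    assume "- complex_of_real e \<in> ?R"
    then have "- Re (- complex_of_real e) \<in> (\<lambda>z. - Re z) ` ?R" by (rule imageI)
    then show False using e by simp
  qed
  then have "\<not> eigenvalue H (- of_real e)" using eigenvalue_root_char_poly[OF H] by simp
  then have "det (H + of_real e \<cdot>\<^sub>m 1\<^sub>m n) \<noteq> 0"
    using eigenvalue_det[OF H] H by (simp add: char_matrix_def)
  then show ?thesis using e that by auto
qed

lemma mult_mat_vec_norm_bound:
  fixes A :: "complex mat"
  assumes A: "A \<in> carrier_mat n n" and v: "v \<in> carrier_vec n"
  shows "(\<Sum>k<n. (cmod ((A *\<^sub>v v) $ k))\<^sup>2)
    \<le> (\<Sum>k<n. (\<Sum>a<n. cmod (A $$ (k, a)))\<^sup>2) * (\<Sum>k<n. (cmod (v $ k))\<^sup>2)"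
proof -
  define s where "s = (\<Sum>k<n. (cmod (v $ k))\<^sup>2)"
  have s: "s \<ge> 0" unfolding s_def by (intro sum_nonneg) auto
  have va: "cmod (v $ a) \<le> sqrt s" if "a < n" for a
    unfolding s_def using that by (intro real_le_rsqrt member_le_sum) auto
  have "(cmod ((A *\<^sub>v v) $ k))\<^sup>2 \<le> (\<Sum>a<n. cmod (A $$ (k, a)))\<^sup>2 * s" if k: "k < n" for k
  proof -
    have "cmod ((A *\<^sub>v v) $ k) \<le> (\<Sum>a<n. cmod (A $$ (k, a)) * cmod (v $ a))"
      unfolding index_mult_mat_vec_sum[OF A v k] norm_mult[symmetric] by (rule norm_sum)
    also have "\<dots> \<le> (\<Sum>a<n. cmod (A $$ (k, a)) * sqrt s)"
      using va by (intro sum_mono mult_left_mono) auto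
    finally have "(cmod ((A *\<^sub>v v) $ k))\<^sup>2 \<le> (\<Sum>a<n. cmod (A $$ (k, a)) * sqrt s)\<^sup>2"
      by (intro power_mono) auto
    then show ?thesis
      using s by (simp add: sum_distrib_right[symmetric] power_mult_distrib)
  qed
  then show ?thesis
    unfolding s_def[symmetric] sum_distrib_right by (intro sum_mono) auto
qed

lemma quadratic_form_shift:
  fixes H :: "complex mat"
  assumes H: "H \<in> carrier_mat n n" and v: "v \<in> carrier_vec n"
  shows "((H + e \<cdot>\<^sub>m 1\<^sub>m n) *\<^sub>v v) \<bullet>c v = (H *\<^sub>v v) \<bullet>c v + e * of_real (\<Sum>k<n. (cmod (v $ k))\<^sup>2)"
proof -
  have He: "H + e \<cdot>\<^sub>m 1\<^sub>m n \<in> carrier_mat n n" using H by auto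
  have "((H + e \<cdot>\<^sub>m 1\<^sub>m n) *\<^sub>v v) \<bullet>c v
      = (\<Sum>i<n. \<Sum>j<n. H $$ (i, j) * v $ j * cnj (v $ i) + (if j = i then e * (v $ i * cnj (v $ i)) else 0))"
    unfolding quadratic_form_sum[OF He v] using H
    by (intro sum.cong refl) (auto simp: algebra_simps)
  also have "\<dots> = (H *\<^sub>v v) \<bullet>c v + e * (\<Sum>i<n. v $ i * cnj (v $ i))"
    unfolding quadratic_form_sum[OF H v] by (simp add: sum.distrib sum_distrib_left)
  finally show ?thesis unfolding cscalar_prod_self[OF v, symmetric] cscalar_prod_sum[OF v] .
qed

text \<open>
  The separating \<open>H\<close> may be singular. Adding \<open>e I\<close> with \<open>e > 0\<close> changes the form of \<open>H - K H K\<^sup>*\<close> by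
  \<open>e (|v|\<^sup>2 - |K\<^sup>* v|\<^sup>2)\<close>, which for small \<open>e\<close> is absorbed by the margin \<open>c |v|\<^sup>2\<close>.
\<close>

lemma block_stein_solution:
  fixes K :: "complex mat"
  assumes K: "K \<in> carrier_mat n n" and n: "n \<ge> 1"
    and nontrivial: "\<And>Y. Y \<in> carrier_mat n n \<Longrightarrow> Y \<noteq> 0\<^sub>m n n \<Longrightarrow> \<exists>q \<in> {..<n} \<times> {..<n}. block_defect \<beta> K Y q \<noteq> 0"
  obtains G where "G \<in> carrier_mat n n" "mat_adjoint G = G" "det G \<noteq> 0"
    "\<And>k l. k < n \<Longrightarrow> l < n \<Longrightarrow> \<beta> k \<noteq> \<beta> l \<Longrightarrow> G $$ (k, l) = 0"
    "\<And>v. v \<in> carrier_vec n \<Longrightarrow> v \<noteq> 0\<^sub>v n \<Longrightarrow>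
      Re ((G *\<^sub>v (mat_adjoint K *\<^sub>v v)) \<bullet>c (mat_adjoint K *\<^sub>v v)) < Re ((G *\<^sub>v v) \<bullet>c v)"
proof -
  obtain H c where H: "H \<in> carrier_mat n n" "mat_adjoint H = H"
    and block: "\<And>k l. k < n \<Longrightarrow> l < n \<Longrightarrow> \<beta> k \<noteq> \<beta> l \<Longrightarrow> H $$ (k, l) = 0" and c: "c > 0"
    and bound: "\<And>v. v \<in> carrier_vec n \<Longrightarrow> c * (\<Sum>k<n. (cmod (v $ k))\<^sup>2)
      \<le> Re ((H *\<^sub>v v) \<bullet>c v) - Re ((H *\<^sub>v (mat_adjoint K *\<^sub>v v)) \<bullet>c (mat_adjoint K *\<^sub>v v))"
    using block_separation[OF K n nontrivial] by blast
  define B where "B = (\<Sum>k<n. (\<Sum>a<n. cmod (mat_adjoint K $$ (k, a)))\<^sup>2)"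
  have B: "B \<ge> 0" unfolding B_def by (intro sum_nonneg) auto
  obtain e where e: "0 < e" "e < c / (B + 1)" and det: "det (H + of_real e \<cdot>\<^sub>m 1\<^sub>m n) \<noteq> 0"
    using invertible_shift_exists[OF H(1), of "c / (B + 1)"] B c by auto
  have "e * (B + 1) < c" using e(2) B by (simp add: pos_less_divide_eq)
  then have eB: "e * B < c" using e(1) by (simp add: algebra_simps)
  define G where "G = H + of_real e \<cdot>\<^sub>m 1\<^sub>m n"
  have G: "G \<in> carrier_mat n n" unfolding G_def using H by auto
  show ?thesis
  proof (rule that[OF G])
    show "mat_adjoint G = G"
    proof (rule eq_matI)
      fix k l assume "k < dim_row G" "l < dim_col G"
      then have kl: "k < n" "l < n" using G by auto
      have "cnj (H $$ (l, k)) = H $$ (k, l)"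
        using arg_cong[OF H(2), of "\<lambda>M. M $$ (k, l)"] kl H(1) by simp
      then show "mat_adjoint G $$ (k, l) = G $$ (k, l)" using kl G H(1) by (simp add: G_def)
    qed (use G in auto)
    show "det G \<noteq> 0" using det unfolding G_def .
    show "G $$ (k, l) = 0" if "k < n" "l < n" "\<beta> k \<noteq> \<beta> l" for k l
      using block[OF that] that H(1) by (auto simp: G_def)
    show "Re ((G *\<^sub>v (mat_adjoint K *\<^sub>v v)) \<bullet>c (mat_adjoint K *\<^sub>v v)) < Re ((G *\<^sub>v v) \<bullet>c v)"
      if v: "v \<in> carrier_vec n" "v \<noteq> 0\<^sub>v n" for v
    proof -
      define w where "w = mat_adjoint K *\<^sub>v v"
      define s where "s = (\<Sum>k<n. (cmod (v $ k))\<^sup>2)"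
      define r where "r = (\<Sum>k<n. (cmod (w $ k))\<^sup>2)"
      have w: "w \<in> carrier_vec n" unfolding w_def using mult_mat_vec_carrier[OF mat_adjoint_carrier[OF K] v(1)] .
      obtain k where "k < n" "v $ k \<noteq> 0" using v by (auto simp: vec_eq_iff)
      then have s: "s > 0" unfolding s_def by (intro sum_pos2[of _ k]) auto
      have "r \<le> B * s"
        unfolding r_def w_def B_def s_def by (rule mult_mat_vec_norm_bound[OF mat_adjoint_carrier[OF K] v(1)])
      then have "e * r \<le> e * B * s" using e(1) by (simp add: mult.assoc)
      also have "\<dots> < c * s" using eB s by simp
      finally have "e * r < c * s" .
      moreover have "e * s > 0" using e(1) s by simp
      ultimately have "e * r < c * s + e * s" by linarith
      moreover have "Re ((G *\<^sub>v v) \<bullet>c v) = Re ((H *\<^sub>v v) \<bullet>c v) + e * s"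
        unfolding G_def quadratic_form_shift[OF H(1) v(1)] s_def by simp
      moreover have "Re ((G *\<^sub>v w) \<bullet>c w) = Re ((H *\<^sub>v w) \<bullet>c w) + e * r"
        unfolding G_def quadratic_form_shift[OF H(1) w] r_def by simp
      ultimately show ?thesis using bound[OF v(1)] unfolding w_def[symmetric] s_def[symmetric] by linarith
    qed
  qed
qed

text \<open>
  The sign of a zero eigenvalue is taken to be 1, with the zero absorbed into \<open>S\<close>. So \<open>J\<close> is always
  a signature matrix, and the invertibility of \<open>S\<close> follows from that of \<open>A\<close>.
\<close>

lemma hermitian_congruence_signature:
  fixes A :: "complex mat"
  assumes "A \<in> carrier_mat n n" "mat_adjoint A = A"
  shows "\<exists>S \<in> carrier_mat n n. \<exists>s. (\<forall>k. s k = 1 \<or> s k = -1) \<and> A = S * real_diag_mat n s * mat_adjoint S"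
proof -
  obtain P d where P: "P \<in> carrier_mat n n" and A: "A = P * real_diag_mat n d * mat_adjoint P"
    using hermitian_diagonalization[OF assms] by blast
  define s where "s k = (if d k \<ge> 0 then 1 else -1 :: real)" for k
  have "P * real_diag_mat n d * mat_adjoint P = (P * real_diag_mat n (\<lambda>k. sqrt \<bar>d k\<bar>)) * real_diag_mat n s
      * mat_adjoint (P * real_diag_mat n (\<lambda>k. sqrt \<bar>d k\<bar>))"
    by (rule real_diag_rescale[OF P]) (auto simp: s_def)
  moreover have "\<forall>k. s k = 1 \<or> s k = -1" by (simp add: s_def)
  ultimately show ?thesis
    unfolding A using mult_carrier_mat[OF P real_diag_mat_carrier] by blast
qed

text \<open>
  Applied block by block, so that the congruence is itself block diagonal; the signs of the blocks
  are strung together into one diagonal.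
\<close>

lemma block_hermitian_congruence_signature:
  fixes G :: "complex mat"
  assumes n: "n = block_offset ns d" and G: "G \<in> carrier_mat n n" "mat_adjoint G = G"
    and block: "\<And>k l. k < n \<Longrightarrow> l < n \<Longrightarrow> block_of ns k \<noteq> block_of ns l \<Longrightarrow> G $$ (k, l) = 0"
  obtains Sb s where "\<And>j. Sb j \<in> carrier_mat (ns j) (ns j)" "\<And>k. s k = 1 \<or> s k = -1"
    "G = direct_sum_mat d Sb * real_diag_mat n s * mat_adjoint (direct_sum_mat d Sb)"
proof -
  define st where "st = block_offset ns"
  define Gb where "Gb j = mat (ns j) (ns j) (\<lambda>(a, b). G $$ (st j + a, st j + b))" for j
  have off: "st j + a < n" if "j < d" "a < ns j" for j a
    unfolding n st_def using that by (rule block_offset_less)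
  have ex: "\<exists>Q. j < d \<longrightarrow> fst Q \<in> carrier_mat (ns j) (ns j) \<and> (\<forall>k. snd Q k = 1 \<or> snd Q k = -1) \<and>
      Gb j = fst Q * real_diag_mat (ns j) (snd Q) * mat_adjoint (fst Q)" for j
  proof (cases "j < d")
    case True
    have Gb: "Gb j \<in> carrier_mat (ns j) (ns j)" unfolding Gb_def by simp
    have "mat_adjoint (Gb j) = Gb j"
    proof (rule eq_matI)
      fix a b assume "a < dim_row (Gb j)" "b < dim_col (Gb j)"
      then have ab: "a < ns j" "b < ns j" using Gb by auto
      have "cnj (G $$ (st j + b, st j + a)) = G $$ (st j + a, st j + b)"
        using arg_cong[OF G(2), of "\<lambda>M. M $$ (st j + a, st j + b)"] off[OF True] ab G(1) by simp
      then show "mat_adjoint (Gb j) $$ (a, b) = Gb j $$ (a, b)" using ab by (simp add: Gb_def)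
    qed (use Gb in auto)
    then obtain S s where "S \<in> carrier_mat (ns j) (ns j)" "\<forall>k. s k = 1 \<or> s k = -1"
      "Gb j = S * real_diag_mat (ns j) s * mat_adjoint S"
      using hermitian_congruence_signature[OF Gb] by blast
    then show ?thesis by (intro exI[of _ "(S, s)"]) simp
  qed simp
  obtain Q where "\<forall>j. j < d \<longrightarrow> fst (Q j) \<in> carrier_mat (ns j) (ns j) \<and> (\<forall>k. snd (Q j) k = 1 \<or> snd (Q j) k = -1) \<and>
      Gb j = fst (Q j) * real_diag_mat (ns j) (snd (Q j)) * mat_adjoint (fst (Q j))"
    using choice[OF allI[OF ex]] by (rule exE)
  then have Q: "j < d \<Longrightarrow> fst (Q j) \<in> carrier_mat (ns j) (ns j)" "j < d \<Longrightarrow> snd (Q j) k = 1 \<or> snd (Q j) k = -1"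
    "j < d \<Longrightarrow> Gb j = fst (Q j) * real_diag_mat (ns j) (snd (Q j)) * mat_adjoint (fst (Q j))" for j k
    by blast+
  define Sb where "Sb j = (if j < d then fst (Q j) else 1\<^sub>m (ns j))" for j
  define s where "s i = (if block_of ns i < d then snd (Q (block_of ns i)) (pos_in_block ns i) else 1)" for i
  have Sb: "Sb j \<in> carrier_mat (ns j) (ns j)" for j unfolding Sb_def using Q(1)[of j] by auto
  have s: "s k = 1 \<or> s k = -1" for k unfolding s_def using Q(2) by auto
  define S where "S = direct_sum_mat d Sb"
  have S: "S \<in> carrier_mat n n" unfolding S_def n using Sb by (rule direct_sum_mat_carrier)
  have S_entry: "S $$ (i, k) = (if block_of ns i = block_of ns k
      then fst (Q (block_of ns i)) $$ (pos_in_block ns i, pos_in_block ns k) else 0)" if "i < n" "k < n" for i k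
    using that block_of_less[of i ns d] unfolding S_def n
    by (subst index_direct_sum_mat[OF Sb]) (auto simp: Sb_def)
  have "G = S * real_diag_mat n s * mat_adjoint S"
  proof (rule eq_matI)
    fix i k assume "i < dim_row (S * real_diag_mat n s * mat_adjoint S)" "k < dim_col (S * real_diag_mat n s * mat_adjoint S)"
    then have ik: "i < n" "k < n" using S by auto
    define j where "j = block_of ns i"
    have j: "j < d" unfolding j_def using ik(1) unfolding n by (rule block_of_less)
    have entry: "(S * real_diag_mat n s * mat_adjoint S) $$ (i, k) = (\<Sum>l<n. of_real (s l) * S $$ (i, l) * cnj (S $$ (k, l)))"
      by (rule index_mult_real_diag_adjoint[OF S ik])
    show "G $$ (i, k) = (S * real_diag_mat n s * mat_adjoint S) $$ (i, k)"
    proof (cases "block_of ns k = j")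
      case False
      then show ?thesis
        unfolding entry using block[OF ik] ik by (auto simp: S_entry j_def intro!: sum.neutral[symmetric])
    next
      case True
      define a b where "a = pos_in_block ns i" and "b = pos_in_block ns k"
      have ab: "a < ns j" "b < ns j" "i = st j + a" "k = st j + b"
        using pos_in_block_less[of i ns d] pos_in_block_less[of k ns d] offset_pos_in_block[of i ns d]
          offset_pos_in_block[of k ns d] ik True unfolding n a_def b_def j_def st_def by auto
      have "(S * real_diag_mat n s * mat_adjoint S) $$ (i, k)
          = (\<Sum>l<n. if block_of ns l = j then of_real (snd (Q j) (pos_in_block ns l)) * fst (Q j) $$ (a, pos_in_block ns l)
              * cnj (fst (Q j) $$ (b, pos_in_block ns l)) else 0)"
        unfolding entry using ik True j
        by (intro sum.cong refl) (auto simp: S_entry s_def a_def b_def j_def)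
      also have "\<dots> = (\<Sum>c<ns j. of_real (snd (Q j) c) * fst (Q j) $$ (a, c) * cnj (fst (Q j) $$ (b, c)))"
        unfolding n sum_block[OF j] by (intro sum.cong refl) simp
      also have "\<dots> = Gb j $$ (a, b)"
        unfolding Q(3)[OF j] by (rule index_mult_real_diag_adjoint[OF Q(1)[OF j] ab(1,2), symmetric])
      also have "\<dots> = G $$ (i, k)" using ab by (simp add: Gb_def)
      finally show ?thesis by simp
    qed
  qed (use S G in auto)
  then show ?thesis using that[of Sb s, OF Sb s] unfolding S_def by blast
qed

text \<open>
  For \<open>B = S\<^sup>-\<^sup>1\<close> and \<open>M = B K S\<close> this is the identity \<open>S (J - M J M\<^sup>*) S\<^sup>* = G - K G K\<^sup>*\<close> with
  \<open>G = S J S\<^sup>*\<close>, read as an identity of quadratic forms at \<open>v\<close>.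
\<close>

lemma quadratic_form_contraction:
  fixes S B K J :: "complex mat"
  assumes S: "S \<in> carrier_mat n n" and B: "B \<in> carrier_mat n n" and K: "K \<in> carrier_mat n n"
    and J: "J \<in> carrier_mat n n" and SB: "S * B = 1\<^sub>m n" and v: "v \<in> carrier_vec n"
  shows "((J - (B * K * S) * J * mat_adjoint (B * K * S)) *\<^sub>v (mat_adjoint S *\<^sub>v v)) \<bullet>c (mat_adjoint S *\<^sub>v v)
    = ((S * J * mat_adjoint S) *\<^sub>v v) \<bullet>c v
      - ((S * J * mat_adjoint S) *\<^sub>v (mat_adjoint K *\<^sub>v v)) \<bullet>c (mat_adjoint K *\<^sub>v v)"
proof -
  define u where "u = mat_adjoint S *\<^sub>v v"
  define w where "w = mat_adjoint K *\<^sub>v v"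
  define M where "M = B * K * S"
  have M: "M \<in> carrier_mat n n" unfolding M_def using B K S by auto
  have u: "u \<in> carrier_vec n" unfolding u_def using mult_mat_vec_carrier[OF mat_adjoint_carrier[OF S] v] .
  have w: "w \<in> carrier_vec n" unfolding w_def using mult_mat_vec_carrier[OF mat_adjoint_carrier[OF K] v] .
  have MJM: "M * J * mat_adjoint M \<in> carrier_mat n n"
    using mult_carrier_mat[OF mult_carrier_mat[OF M J] mat_adjoint_carrier[OF M]] .
  have BK: "B * K \<in> carrier_mat n n" using B K by auto
  have "mat_adjoint B *\<^sub>v u = mat_adjoint (S * B) *\<^sub>v v"
    unfolding u_def mat_adjoint_mult[OF S B]
    by (rule assoc_mult_mat_vec[OF mat_adjoint_carrier[OF B] mat_adjoint_carrier[OF S] v, symmetric])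
  then have Bu: "mat_adjoint B *\<^sub>v u = v" using SB v by simp
  have "mat_adjoint M *\<^sub>v u = mat_adjoint S *\<^sub>v (mat_adjoint (B * K) *\<^sub>v u)"
    unfolding M_def mat_adjoint_mult[OF BK S]
    by (rule assoc_mult_mat_vec[OF mat_adjoint_carrier[OF S] mat_adjoint_carrier[OF BK] u])
  also have "mat_adjoint (B * K) *\<^sub>v u = mat_adjoint K *\<^sub>v (mat_adjoint B *\<^sub>v u)"
    unfolding mat_adjoint_mult[OF B K]
    by (rule assoc_mult_mat_vec[OF mat_adjoint_carrier[OF K] mat_adjoint_carrier[OF B] u])
  finally have Mu: "mat_adjoint M *\<^sub>v u = mat_adjoint S *\<^sub>v w" unfolding Bu w_def .
  have "((J - M * J * mat_adjoint M) *\<^sub>v u) \<bullet>c u = (J *\<^sub>v u) \<bullet>c u - ((M * J * mat_adjoint M) *\<^sub>v u) \<bullet>c u"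
    unfolding minus_mult_distrib_mat_vec[OF J MJM u]
    using mult_mat_vec_carrier[OF J u] mult_mat_vec_carrier[OF MJM u] u
    by (intro minus_scalar_prod_distrib) auto
  also have "((M * J * mat_adjoint M) *\<^sub>v u) \<bullet>c u = ((S * J * mat_adjoint S) *\<^sub>v w) \<bullet>c w"
    unfolding quadratic_form_congruence[OF J M u] Mu quadratic_form_congruence[OF J S w] ..
  also have "(J *\<^sub>v u) \<bullet>c u = ((S * J * mat_adjoint S) *\<^sub>v v) \<bullet>c v"
    unfolding quadratic_form_congruence[OF J S v] u_def ..
  finally show ?thesis unfolding u_def w_def M_def .
qed

lemma mat_inverse_of_det_nonzero:
  fixes S :: "complex mat"
  assumes S: "S \<in> carrier_mat n n" and "det S \<noteq> 0"
  shows "the (mat_inverse S) \<in> carrier_mat n n" "S * the (mat_inverse S) = 1\<^sub>m n" "the (mat_inverse S) * S = 1\<^sub>m n"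
proof -
  have "mat_inverse S \<noteq> None"
    using mat_inverse(1)[OF S, of "()"] det_non_zero_imp_unit[OF assms, of "()"] by blast
  then obtain B where "mat_inverse S = Some B" by blast
  then show "the (mat_inverse S) \<in> carrier_mat n n" "S * the (mat_inverse S) = 1\<^sub>m n" "the (mat_inverse S) * S = 1\<^sub>m n"
    using mat_inverse(2)[OF S] by auto
qed

lemma invertible_mat_iff_det:
  fixes S :: "complex mat"
  assumes S: "S \<in> carrier_mat n n"
  shows "invertible_mat S \<longleftrightarrow> det S \<noteq> 0"
proof
  assume "invertible_mat S"
  then obtain B where B: "S * B = 1\<^sub>m n" "B * S = 1\<^sub>m (dim_row B)"
    using S unfolding invertible_mat_def inverts_mat_def by auto
  have "dim_col (S * B) = n" "dim_col (B * S) = dim_row B" unfolding B by simp_all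
  then have "B \<in> carrier_mat n n" using S by auto
  then have "det S * det B = 1" using det_mult[OF S] B(1) by (metis det_one)
  then show "det S \<noteq> 0" by auto
next
  assume "det S \<noteq> 0"
  note B = mat_inverse_of_det_nonzero[OF S this]
  then show "invertible_mat S" using S unfolding invertible_mat_def inverts_mat_def by (metis carrier_matD square_mat.simps)
qed

lemma adjoint_mult_vec_nonzero:
  fixes S B :: "complex mat"
  assumes S: "S \<in> carrier_mat n n" and B: "B \<in> carrier_mat n n" and SB: "S * B = 1\<^sub>m n"
    and v: "v \<in> carrier_vec n" "v \<noteq> 0\<^sub>v n"
  shows "mat_adjoint S *\<^sub>v v \<noteq> 0\<^sub>v n"
proof
  assume "mat_adjoint S *\<^sub>v v = 0\<^sub>v n"
  then have "mat_adjoint B *\<^sub>v (mat_adjoint S *\<^sub>v v) = 0\<^sub>v n" using B by (intro eq_vecI) auto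
  then have "mat_adjoint (S * B) *\<^sub>v v = 0\<^sub>v n"
    unfolding mat_adjoint_mult[OF S B] assoc_mult_mat_vec[OF mat_adjoint_carrier[OF B] mat_adjoint_carrier[OF S] v(1)] .
  then show False using v SB by simp
qed

lemma real_diag_signature:
  assumes "\<And>k. s k = 1 \<or> s k = -1"
  shows "signature_mat (real_diag_mat n s)"
proof -
  have "real_diag_mat n s * real_diag_mat n s = 1\<^sub>m n"
  proof (rule eq_matI)
    fix i j assume "i < dim_row (1\<^sub>m n :: complex mat)" "j < dim_col (1\<^sub>m n :: complex mat)"
    then have ij: "i < n" "j < n" by auto
    have "(real_diag_mat n s * real_diag_mat n s) $$ (i, j) = (\<Sum>k<n. if k = i then (if i = j then of_real (s i * s i) else 0) else 0)"
      unfolding index_mult_mat_sum[OF real_diag_mat_carrier real_diag_mat_carrier ij] using ij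
      by (intro sum.cong refl) (auto simp: real_diag_mat_def)
    then show "(real_diag_mat n s * real_diag_mat n s) $$ (i, j) = 1\<^sub>m n $$ (i, j)"
      using ij assms[of i] by auto
  qed (auto simp: real_diag_mat_def)
  moreover have "mat_adjoint (real_diag_mat n s) = real_diag_mat n s"
    by (intro eq_matI) (auto simp: real_diag_mat_def)
  ultimately show ?thesis
    unfolding signature_mat_def inverts_mat_def by (auto simp: real_diag_mat_def)
qed

lemma index_mult_diagonal_adjoint:
  fixes S J :: "complex mat"
  assumes S: "S \<in> carrier_mat n n" and J: "J \<in> carrier_mat n n" "diagonal_mat J" and ik: "i < n" "k < n"
  shows "(S * J * mat_adjoint S) $$ (i, k) = (\<Sum>l<n. S $$ (i, l) * J $$ (l, l) * cnj (S $$ (k, l)))"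
proof -
  have "(S * J) $$ (i, l) = S $$ (i, l) * J $$ (l, l)" if l: "l < n" for l
  proof -
    have "(S * J) $$ (i, l) = (\<Sum>a<n. if a = l then S $$ (i, l) * J $$ (l, l) else 0)"
      unfolding index_mult_mat_sum[OF S J(1) ik(1) l] using J l
      by (intro sum.cong refl) (auto simp: diagonal_mat_def)
    then show ?thesis using l by simp
  qed
  then show ?thesis
    using index_mult_mat_sum[OF mult_carrier_mat[OF S J(1)] mat_adjoint_carrier[OF S] ik] S ik
    by (simp del: index_mult_mat(1))
qed

theorem theorem1p2:
  fixes d n :: nat and ns :: "nat \<Rightarrow> nat" and p :: cmpoly and K :: "complex mat"
  assumes "d \<ge> 1"
    and "\<And>j. j < d \<Longrightarrow> ns j \<ge> 1"
    and "n = (\<Sum>j<d. ns j)"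
    and "poly_in_vars d p"
    and "poly_eval p (\<lambda>_. 0) \<noteq> 0"
    and "K \<in> carrier_mat n n"
    and "det_rep d ns K p"
  defines "stmt_i \<equiv> \<forall>m \<ge> 1. \<forall>U :: nat \<Rightarrow> complex mat.
      (\<forall>j<d. U j \<in> carrier_mat m m \<and> unitary_mat (U j)) \<longrightarrow> eval_at_mats d ns K p m U \<noteq> 0"
    and "stmt_ii \<equiv> \<forall>m \<in> {1..n}. \<forall>U :: nat \<Rightarrow> complex mat.
      (\<forall>j<d. U j \<in> carrier_mat m m \<and> unitary_mat (U j)) \<longrightarrow> eval_at_mats d ns K p m U \<noteq> 0"
    and "stmt_iii \<equiv> \<exists>(Sb :: nat \<Rightarrow> complex mat) S.
      (\<forall>j<d. Sb j \<in> carrier_mat (ns j) (ns j)) \<and> S = direct_sum_mat d Sb \<and> invertible_mat S \<and>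
      (\<exists>J \<in> carrier_mat n n. diagonal_mat J \<and> signature_mat J \<and>
         strict_contraction_wrt J (the (mat_inverse S) * K * S))"
  shows "(stmt_i \<longleftrightarrow> stmt_ii) \<and> (stmt_ii \<longleftrightarrow> stmt_iii)"
proof -
  let ?\<beta> = "block_of ns"
  let ?inv = "\<lambda>S :: complex mat. the (mat_inverse S)"
  have n: "n = block_offset ns d" using assms(3) by (simp add: block_offset_def)
  have K: "K \<in> carrier_mat n n" by fact
  have "ns 0 \<le> n"
    using assms(1) unfolding assms(3) by (intro member_le_sum) auto
  then have n1: "n \<ge> 1" using assms(1) assms(2)[of 0] by simp
  have zeros: "(\<forall>U. (\<forall>j<d. U j \<in> carrier_mat m m \<and> unitary_mat (U j)) \<longrightarrow> eval_at_mats d ns K p m U \<noteq> 0)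
      \<longleftrightarrow> (\<forall>Y \<in> carrier_mat n m. Y \<noteq> 0\<^sub>m n m \<longrightarrow> (\<exists>q \<in> {..<n} \<times> {..<n}. block_defect ?\<beta> K Y q \<noteq> 0))" for m
    using zero_at_unitaries_iff[OF n K assms(5), of m] by blast
  have "stmt_i \<Longrightarrow> stmt_ii"
    unfolding stmt_i_def stmt_ii_def by simp
  moreover have stmt_iii if "stmt_ii"
  proof -
    have "\<exists>q \<in> {..<n} \<times> {..<n}. block_defect ?\<beta> K Y q \<noteq> 0" if "Y \<in> carrier_mat n n" "Y \<noteq> 0\<^sub>m n n" for Y
      using \<open>stmt_ii\<close> n1 zeros[of n] that unfolding stmt_ii_def by auto
    then obtain G where G: "G \<in> carrier_mat n n" "mat_adjoint G = G" "det G \<noteq> 0"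
      and block: "\<And>k l. k < n \<Longrightarrow> l < n \<Longrightarrow> ?\<beta> k \<noteq> ?\<beta> l \<Longrightarrow> G $$ (k, l) = 0"
      and pos: "\<And>v. v \<in> carrier_vec n \<Longrightarrow> v \<noteq> 0\<^sub>v n \<Longrightarrow>
        Re ((G *\<^sub>v (mat_adjoint K *\<^sub>v v)) \<bullet>c (mat_adjoint K *\<^sub>v v)) < Re ((G *\<^sub>v v) \<bullet>c v)"
      using block_stein_solution[OF K n1, of ?\<beta>] by metis
    obtain Sb s where Sb: "\<And>j. Sb j \<in> carrier_mat (ns j) (ns j)" and s: "\<And>k. s k = 1 \<or> s k = -1"
      and GS: "G = direct_sum_mat d Sb * real_diag_mat n s * mat_adjoint (direct_sum_mat d Sb)"
      using block_hermitian_congruence_signature[OF n G(1,2) block] by blast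
    define S where "S = direct_sum_mat d Sb"
    define J where "J = real_diag_mat n s"
    have S: "S \<in> carrier_mat n n" unfolding S_def n using Sb by (rule direct_sum_mat_carrier)
    have J: "J \<in> carrier_mat n n" unfolding J_def by simp
    have GSJ: "S * J * mat_adjoint S = G" unfolding S_def J_def GS ..
    have "det G = det S * det J * det (mat_adjoint S)"
      unfolding GSJ[symmetric] using S J by (simp add: det_mult[of _ n])
    then have detS: "det S \<noteq> 0" using G(3) by auto
    note B = mat_inverse_of_det_nonzero[OF S detS]
    define M where "M = ?inv S * K * S"
    have M: "M \<in> carrier_mat n n" unfolding M_def using B(1) K S by auto
    have JH: "mat_adjoint J = J"
      using real_diag_signature[of s n] s unfolding J_def signature_mat_def by blast
    have MJM: "M * J * mat_adjoint M \<in> carrier_mat n n"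
      using mult_carrier_mat[OF mult_carrier_mat[OF M J] mat_adjoint_carrier[OF M]] .
    define T where "T = J - M * J * mat_adjoint M"
    have T: "T \<in> carrier_mat n n" unfolding T_def by (rule minus_carrier_mat[OF MJM])
    have TH: "mat_adjoint T = T"
    proof (rule eq_matI)
      fix k l assume "k < dim_row T" "l < dim_col T"
      then have kl: "k < n" "l < n" using T by auto
      have herm: "cnj (A $$ (l, k)) = A $$ (k, l)" if "A \<in> carrier_mat n n" "mat_adjoint A = A" for A
        using arg_cong[OF that(2), of "\<lambda>A. A $$ (k, l)"] kl that(1) by simp
      have "T $$ (a, b) = J $$ (a, b) - (M * J * mat_adjoint M) $$ (a, b)" if "a < n" "b < n" for a b
        unfolding T_def using that MJM by (intro index_minus_mat) auto
      then show "mat_adjoint T $$ (k, l) = T $$ (k, l)"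
        using herm[OF J JH] herm[OF MJM mat_adjoint_congruence[OF J JH M]] kl T
        by (simp del: index_mult_mat(1))
    qed (use T in auto)
    have "Re ((T *\<^sub>v u) \<bullet>c u) > 0" if u: "u \<in> carrier_vec n" "u \<noteq> 0\<^sub>v n" for u
    proof -
      define v where "v = mat_adjoint (?inv S) *\<^sub>v u"
      have v: "v \<in> carrier_vec n"
        unfolding v_def using mult_mat_vec_carrier[OF mat_adjoint_carrier[OF B(1)] u(1)] .
      have v0: "v \<noteq> 0\<^sub>v n"
        unfolding v_def by (rule adjoint_mult_vec_nonzero[OF B(1) S B(3) u])
      have "mat_adjoint S *\<^sub>v v = mat_adjoint (?inv S * S) *\<^sub>v u"
        unfolding v_def mat_adjoint_mult[OF B(1) S]
        by (rule assoc_mult_mat_vec[OF mat_adjoint_carrier[OF S] mat_adjoint_carrier[OF B(1)] u(1), symmetric])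
      then have "mat_adjoint S *\<^sub>v v = u" unfolding B(3) using u(1) by simp
      then have "(T *\<^sub>v u) \<bullet>c u = (G *\<^sub>v v) \<bullet>c v - (G *\<^sub>v (mat_adjoint K *\<^sub>v v)) \<bullet>c (mat_adjoint K *\<^sub>v v)"
        using quadratic_form_contraction[OF S B(1) K J B(2) v] unfolding GSJ T_def M_def by simp
      then show ?thesis using pos[OF v v0] by simp
    qed
    then have "strict_contraction_wrt J M"
      using T TH unfolding strict_contraction_wrt_def positive_definite_mat_def T_def[symmetric] by auto
    moreover have "diagonal_mat J"
      unfolding J_def diagonal_mat_def real_diag_mat_def by auto
    moreover have "signature_mat J" unfolding J_def using s by (rule real_diag_signature)
    moreover have "invertible_mat S" unfolding invertible_mat_iff_det[OF S] by (rule detS)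
    ultimately show ?thesis
      unfolding stmt_iii_def M_def using Sb S_def J by blast
  qed
  moreover have stmt_i if "stmt_iii"
  proof -
    obtain Sb S J where Sb: "\<forall>j<d. Sb j \<in> carrier_mat (ns j) (ns j)" and S_def: "S = direct_sum_mat d Sb"
      and inv: "invertible_mat S" and J: "J \<in> carrier_mat n n" "diagonal_mat J"
      and contr: "strict_contraction_wrt J (?inv S * K * S)"
      using \<open>stmt_iii\<close> unfolding stmt_iii_def by blast
    have S: "S \<in> carrier_mat n n" unfolding S_def n using Sb by (intro direct_sum_mat_carrier) auto
    have detS: "det S \<noteq> 0" using inv unfolding invertible_mat_iff_det[OF S] .
    note B = mat_inverse_of_det_nonzero[OF S detS]
    define G where "G = S * J * mat_adjoint S"
    have G: "G \<in> carrier_mat n n"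
      unfolding G_def using mult_carrier_mat[OF mult_carrier_mat[OF S J(1)] mat_adjoint_carrier[OF S]] .
    have S_block: "S $$ (i, l) = 0" if "i < n" "l < n" "?\<beta> i \<noteq> ?\<beta> l" for i l
      using index_direct_sum_mat[of d Sb ns i l] Sb that unfolding S_def n by simp
    have block: "G $$ (i, k) = 0" if "i < n" "k < n" "?\<beta> i \<noteq> ?\<beta> k" for i k
      unfolding G_def index_mult_diagonal_adjoint[OF S J that(1,2)]
    proof (rule sum.neutral, intro ballI)
      fix l assume "l \<in> {..<n}"
      then show "S $$ (i, l) * J $$ (l, l) * cnj (S $$ (k, l)) = 0"
        using S_block[of i l] S_block[of k l] that by (cases "?\<beta> i = ?\<beta> l") auto
    qed
    have pos: "Re ((G *\<^sub>v (mat_adjoint K *\<^sub>v v)) \<bullet>c (mat_adjoint K *\<^sub>v v)) < Re ((G *\<^sub>v v) \<bullet>c v)"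
      if v: "v \<in> carrier_vec n" "v \<noteq> 0\<^sub>v n" for v
    proof -
      define u where "u = mat_adjoint S *\<^sub>v v"
      define T where "T = J - (?inv S * K * S) * J * mat_adjoint (?inv S * K * S)"
      have dimT: "dim_row T = n" unfolding T_def using B(1) by simp
      have u: "u \<in> carrier_vec n" unfolding u_def using mult_mat_vec_carrier[OF mat_adjoint_carrier[OF S] v(1)] .
      have "u \<noteq> 0\<^sub>v n" unfolding u_def by (rule adjoint_mult_vec_nonzero[OF S B(1,2) v])
      then have "0 < Re ((T *\<^sub>v u) \<bullet>c u)"
        using contr u unfolding strict_contraction_wrt_def positive_definite_mat_def T_def[symmetric] dimT by blast
      then show ?thesis
        unfolding T_def u_def quadratic_form_contraction[OF S B(1) K J(1) B(2) v(1)] G_def by simp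
    qed
    show ?thesis
      unfolding stmt_i_def zeros using defect_of_stein_positive[OF G K block pos] by blast
  qed
  ultimately show ?thesis by blast
qed

end
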